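(* Let $\varphi(z)=\frac{1}{\sqrt{2\pi}}e^{-z^2/2}$ and $\Psi(z)=\int_z^\infty\varphi(w)\,dw$ for $z\in\mathbb{C}$, and let $H_+=\{z\in\mathbb{C}:\Re z\ge 0\}$. (I) The function $\Psi$ has no zeros in $H_+$. So, with $R:=\varphi/\Psi$, the function $S\colon H_+\to\mathbb{C}$ defined by $$S(z):=\frac{R(z)}{z+\sqrt{2/\pi}},\qquad z\in H_+,$$ is holomorphic on the interior of $H_+$. (II) The function $y\mapsto|S(iy)|$ has exactly one minimizer $y_*$ on $(0,\infty)$, with $y_*=1.6267\ldots$ and $|S(iy_* )|=0.686\ldots$, and $$1>|S(z)|>|S(iy_* )|\qquad\text{for all } z\in H_+\setminus\{0,\,iy_*,\,-iy_*\}.$$ (III) The lower bound $|S(iy_* )|$ on $|S(z)|$ in (II) is exact (i.e. it cannot be replaced by a larger constant). The upper bound $1$ in (II) is also exact, in the following strong sense: $$S(0)=1=\lim_{H_+\ni z\to\infty}S(z).$$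
   Context: $\Psi$ is an entire function: the integral $\int_z^\infty\varphi(w)\,dw$ is taken along any path from $z$ to the point $\infty=\infty+0i$ of the extended real axis; equivalently $\Psi(z)=\frac12\operatorname{erfc}(z/\sqrt2)$. $R=\varphi/\Psi$ is the inverse Mills ratio. The limit "$H_+\ni z\to\infty$" means $|z|\to\infty$ with $z\in H_+$. Notation such as $y_*=1.6267\ldots$ gives the leading decimal digits, i.e. $1.6267\le y_*<1.6268$; likewise $0.686\ldots$ means a number in $[0.686,0.687)$. *)

theory Defs
  imports "HOL-Complex_Analysis.Complex_Analysis" "HOL-Probability.Probability"
begin

definition gauss_phi :: "complex \<Rightarrow> complex" where
  "gauss_phi z = exp (- (z\<^sup>2) / 2) / complex_of_real (sqrt (2 * pi))"

(* The integral of gauss_phi from z to \<infinity> + 0i, taken along the segment from z to 0 followed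
   by the positive real axis. Any other path gives the same value: see Psi_any_path. *)
definition Psi :: "complex \<Rightarrow> complex" where
  "Psi z = contour_integral (linepath z 0) gauss_phi
             + integral {0..} (\<lambda>t::real. gauss_phi (complex_of_real t))"

definition inv_mills :: "complex \<Rightarrow> complex" where
  "inv_mills z = gauss_phi z / Psi z"

definition H_plus :: "complex set" where
  "H_plus = {z. Re z \<ge> 0}"

(* Only the values on H_plus are meant; there the denominators do not vanish. *)
definition S_ratio :: "complex \<Rightarrow> complex" where
  "S_ratio z = inv_mills z / (z + complex_of_real (sqrt (2 / pi)))"

lemma gauss_phi_holomorphic: "gauss_phi holomorphic_on A"
  unfolding gauss_phi_def by (intro holomorphic_intros) auto

lemma norm_gauss_phi: "norm (gauss_phi z) = exp (((Im z)\<^sup>2 - (Re z)\<^sup>2) / 2) / sqrt (2 * pi)"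
  by (simp add: gauss_phi_def norm_divide power2_eq_square field_simps)

lemma gauss_phi_of_real: "gauss_phi (complex_of_real t) = complex_of_real (std_normal_density t)"
  by (simp add: gauss_phi_def std_normal_density_def flip: exp_of_real)

lemma has_integral_std_normal_half: "(std_normal_density has_integral (1/2)) {0..}"
proof -
  have "has_bochner_integral lborel (\<lambda>x::real. indicator {0..} (0 + (1 / sqrt 2) * x) *\<^sub>R exp (- (0 + (1 / sqrt 2) * x)\<^sup>2))
      ((sqrt pi / 2) /\<^sub>R \<bar>1 / sqrt 2\<bar>)"
    using gaussian_moment_0
    by (subst lborel_has_bochner_integral_real_affine_iff[symmetric]) auto
  from has_bochner_integral_mult_right[OF this, of "1 / sqrt (2*pi)"]
  have "has_bochner_integral lborel (\<lambda>x. indicator {0..} x *\<^sub>R std_normal_density x) (1/2)"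
    by (rule has_bochner_integral_cong[THEN iffD1, rotated -1])
       (auto simp: std_normal_density_def indicator_def field_simps power_divide real_sqrt_mult
          zero_le_divide_iff zero_le_mult_iff)
  then have "set_integrable lborel {0..} std_normal_density"
    and "(LINT x:{0..}|lborel. std_normal_density x) = 1/2"
    by (auto simp: set_integrable_def set_lebesgue_integral_def has_bochner_integral_iff)
  then show ?thesis
    by (simp add: set_borel_integral_eq_integral has_integral_iff)
qed

lemma has_integral_gauss_phi: "((\<lambda>t. gauss_phi (complex_of_real t)) has_integral (1/2)) {0..}"
  using has_integral_of_real[OF has_integral_std_normal_half, where 'b = complex]
  by (simp add: gauss_phi_of_real)

lemma Psi_altdef: "Psi z = contour_integral (linepath z 0) gauss_phi + 1/2"
  unfolding Psi_def using has_integral_gauss_phi by (simp add: integral_unique)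

lemma Psi_0: "Psi 0 = 1/2"
  by (simp add: Psi_altdef)

lemma has_field_derivative_Psi: "(Psi has_field_derivative (- gauss_phi z)) (at z within A)"
proof -
  obtain F where F: "\<And>w. (F has_field_derivative gauss_phi w) (at w)"
    using holomorphic_convex_primitive'[OF convex_UNIV open_UNIV gauss_phi_holomorphic]
    by (metis UNIV_I)
  have "contour_integral (linepath w 0) gauss_phi = F 0 - F w" for w
    using contour_integral_unique[OF contour_integral_primitive[of UNIV F gauss_phi "linepath w 0", OF F]]
    by simp
  then have *: "Psi = (\<lambda>w. F 0 - F w + 1/2)"
    by (simp add: Psi_altdef fun_eq_iff)
  have "((\<lambda>w. F 0 - F w + 1/2) has_field_derivative (0 - gauss_phi z + 0)) (at z)"
    by (intro DERIV_add DERIV_diff DERIV_const F)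
  then have "(Psi has_field_derivative (- gauss_phi z)) (at z)"
    by (simp add: *)
  then show ?thesis
    by (rule has_field_derivative_at_within)
qed

lemma Psi_entire: "Psi holomorphic_on A"
  unfolding holomorphic_on_def field_differentiable_def
  using has_field_derivative_Psi by blast

lemma contour_integral_gauss_phi:
  assumes "valid_path g"
  shows "contour_integral g gauss_phi = Psi (pathstart g) - Psi (pathfinish g)"
proof -
  have "((\<lambda>w. - Psi w) has_field_derivative gauss_phi w) (at w within UNIV)" for w
    using DERIV_minus[OF has_field_derivative_Psi] by simp
  then have "(gauss_phi has_contour_integral (- Psi (pathfinish g) - - Psi (pathstart g))) g"
    by (rule contour_integral_primitive) (use assms in auto)
  from contour_integral_unique[OF this] show ?thesis
    by simp
qed

lemma Psi_of_real_tendsto_0: "((\<lambda>x. Psi (complex_of_real x)) \<longlongrightarrow> 0) at_top"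
proof -
  have int: "set_integrable lborel A std_normal_density" if "A \<in> sets lborel" for A
    unfolding set_integrable_def
    using that by (intro integrable_mult_indicator integrable_normal_density) auto
  have "((\<lambda>x. LINT t:{0..x}|lborel. std_normal_density t) \<longlongrightarrow>
          (LINT t:{0..}|lborel. std_normal_density t)) at_top"
    by (rule tendsto_set_lebesgue_integral_at_top) (auto intro!: int)
  moreover have "(LINT t:A|lborel. std_normal_density t) = integral A std_normal_density"
    if "A \<in> sets lborel" for A
    using set_borel_integral_eq_integral(2)[OF int[OF that]] .
  ultimately have "((\<lambda>x. integral {0..x} std_normal_density) \<longlongrightarrow> 1/2) at_top"
    using has_integral_std_normal_half by (simp add: integral_unique)
  then have "((\<lambda>x. 1/2 - complex_of_real (integral {0..x} std_normal_density)) \<longlongrightarrow> 1/2 - complex_of_real (1/2)) at_top"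
    by (intro tendsto_intros)
  then have lim: "((\<lambda>x. 1/2 - complex_of_real (integral {0..x} std_normal_density)) \<longlongrightarrow> 0) at_top"
    by simp
  have "Psi (complex_of_real x) = 1/2 - complex_of_real (integral {0..x} std_normal_density)"
    if "x \<ge> 0" for x
  proof -
    have "((\<lambda>t. - Psi (complex_of_real t)) has_vector_derivative gauss_phi (complex_of_real t)) (at t within {0..x})" for t
      using field_vector_diff_chain_within[OF has_vector_derivative_of_real[OF DERIV_ident]
          DERIV_minus[OF has_field_derivative_Psi]]
      by (simp add: o_def)
    from fundamental_theorem_of_calculus[OF that this]
    have "((\<lambda>t. complex_of_real (std_normal_density t)) has_integral
            (1/2 - Psi (complex_of_real x))) {0..x}"
      by (simp add: Psi_0 gauss_phi_of_real)
    moreover have "((\<lambda>t. complex_of_real (std_normal_density t)) has_integral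
        complex_of_real (integral {0..x} std_normal_density)) {0..x}"
      by (intro has_integral_of_real integrable_integral set_borel_integral_eq_integral(1) int) auto
    ultimately have "1/2 - Psi (complex_of_real x) = complex_of_real (integral {0..x} std_normal_density)"
      by (rule has_integral_unique)
    then show ?thesis
      by (metis diff_diff_eq2 add_diff_cancel_left')
  qed
  with lim show ?thesis
    by (elim Lim_transform_eventually) (auto intro: eventually_mono[OF eventually_ge_at_top[of 0]])
qed

lemma Psi_any_path:
  fixes g :: "'i \<Rightarrow> real \<Rightarrow> complex"
  assumes "\<forall>\<^sub>F i in F. valid_path (g i) \<and> pathstart (g i) = z"
    and re: "filterlim (\<lambda>i. Re (pathfinish (g i))) at_top F"
    and im: "((\<lambda>i. Im (pathfinish (g i))) \<longlongrightarrow> 0) F"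
  shows "((\<lambda>i. contour_integral (g i) gauss_phi) \<longlongrightarrow> Psi z) F"
proof -
  have bound: "norm (Psi w - Psi (complex_of_real (Re w))) \<le> exp ((Im w)\<^sup>2 / 2) * \<bar>Im w\<bar>" for w
  proof -
    have "norm (contour_integral (linepath w (complex_of_real (Re w))) gauss_phi)
        \<le> exp ((Im w)\<^sup>2 / 2) * norm (complex_of_real (Re w) - w)"
    proof (rule contour_integral_bound_linepath)
      show "gauss_phi contour_integrable_on linepath w (complex_of_real (Re w))"
        by (intro contour_integrable_continuous_linepath holomorphic_on_imp_continuous_on
              gauss_phi_holomorphic)
      fix u assume "u \<in> closed_segment w (complex_of_real (Re w))"
      then obtain s where s: "0 \<le> s" "s \<le> 1" "u = (1 - s) *\<^sub>R w + s *\<^sub>R complex_of_real (Re w)"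
        by (auto simp: closed_segment_def)
      then have "\<bar>Im u\<bar> \<le> \<bar>Im w\<bar>"
        by (simp add: abs_mult mult_left_le_one_le)
      then have "(Im u)\<^sup>2 \<le> (Im w)\<^sup>2"
        by (simp add: abs_le_square_iff)
      moreover have "(Re u)\<^sup>2 \<ge> 0"
        by simp
      ultimately have "exp (((Im u)\<^sup>2 - (Re u)\<^sup>2) / 2) \<le> exp ((Im w)\<^sup>2 / 2)"
        by (intro exp_le_cancel_iff[THEN iffD2] divide_right_mono) linarith+
      moreover have "1 \<le> sqrt (2 * pi)"
        using pi_gt3 by simp
      ultimately have "exp (((Im u)\<^sup>2 - (Re u)\<^sup>2) / 2) / sqrt (2 * pi) \<le> exp ((Im w)\<^sup>2 / 2) / 1"
        by (intro frac_le) auto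
      then show "norm (gauss_phi u) \<le> exp ((Im w)\<^sup>2 / 2)"
        by (simp add: norm_gauss_phi)
    qed auto
    moreover have "norm (complex_of_real (Re w) - w) = \<bar>Im w\<bar>"
      by (simp add: cmod_def)
    ultimately show ?thesis
      by (simp add: contour_integral_gauss_phi)
  qed
  let ?p = "\<lambda>i. pathfinish (g i)"
  have "((\<lambda>i. exp ((Im (?p i))\<^sup>2 / 2) * \<bar>Im (?p i)\<bar>) \<longlongrightarrow> exp (0\<^sup>2 / 2) * \<bar>0\<bar>) F"
    by (intro tendsto_mult tendsto_exp tendsto_divide tendsto_power tendsto_rabs tendsto_const im) simp
  then have "((\<lambda>i. exp ((Im (?p i))\<^sup>2 / 2) * \<bar>Im (?p i)\<bar>) \<longlongrightarrow> 0) F"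
    by simp
  then have "((\<lambda>i. Psi (?p i) - Psi (complex_of_real (Re (?p i)))) \<longlongrightarrow> 0) F"
    by (rule Lim_null_comparison[OF always_eventually, rotated]) (intro allI bound)
  from tendsto_add[OF this filterlim_compose[OF Psi_of_real_tendsto_0 re]]
  have "((\<lambda>i. Psi (?p i)) \<longlongrightarrow> 0) F"
    by simp
  from tendsto_diff[OF tendsto_const[of "Psi z"] this]
  have lim: "((\<lambda>i. Psi z - Psi (?p i)) \<longlongrightarrow> Psi z) F"
    by simp
  have "\<forall>\<^sub>F i in F. Psi z - Psi (?p i) = contour_integral (g i) gauss_phi"
    using assms(1) by (rule eventually_mono) (simp add: contour_integral_gauss_phi)
  with lim show ?thesis
    by (rule Lim_transform_eventually)
qed

end

theory Submission
  imports Defs "HOL-Real_Asymp.Real_Asymp"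
begin

text \<open>
  With the Mills ratio M = Psi / phi one has 1 / S(z) = M(z) (z + sqrt (2 / pi)), an entire
  function. Integrating by parts in M(z) = \<integral> exp (- z t - t^2 / 2) dt over t > 0 shows
  that |z M(z) - 1| < 1 for Re z > 0, so Psi has no zeros in the half-plane, and that
  z (z M(z) - 1) is bounded there, so S tends to 1 at infinity. The maximum modulus principle,
  applied to S and to 1 / S, reduces both bounds to the imaginary axis.

  There |S(iy)|^(-2) = G(y) = (y^2 + 2 / pi) (pi / 2 + E(y)^2) exp (- y^2), where
  E(y) is the integral of exp (t^2 / 2) over [0, y]. The sign of G' is that of an expression
  which, after division by a rational function of y, becomes strictly decreasing: two rounds of
  differentiating and dividing by the coefficient of the transcendental term leave only a
  polynomial inequality. Hence G increases to a single maximum and then decreases to 1, and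
  evaluating E and exp at 1.6267 and 1.6268 locates the maximum.
\<close>

section \<open>The imaginary axis\<close>

text \<open>This is the integral of exp (t^2 / 2) over [0, y], that is, sqrt (pi / 2) * erfi (y /
  sqrt 2). Reading it off from \<open>Psi\<close> leaves only its derivative to be computed.\<close>

definition erfi_half :: "real \<Rightarrow> real" where
  "erfi_half y = - sqrt (2 * pi) * Im (Psi (\<i> * complex_of_real y))"

lemma gauss_phi_imaginary:
  "gauss_phi (\<i> * complex_of_real y) = complex_of_real (exp (y\<^sup>2 / 2) / sqrt (2 * pi))"
  by (simp add: gauss_phi_def power_mult_distrib flip: exp_of_real)

lemma has_vector_derivative_Psi_imaginary:
  "((\<lambda>y. Psi (\<i> * complex_of_real y)) has_vector_derivative
     - \<i> * complex_of_real (exp (y\<^sup>2 / 2) / sqrt (2 * pi))) (at y)"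
proof -
  have "((\<lambda>y. \<i> * complex_of_real y) has_vector_derivative \<i>) (at y)"
    using has_vector_derivative_mult_right[OF has_vector_derivative_of_real[OF DERIV_ident]] by fastforce
  from field_vector_diff_chain_at[OF this has_field_derivative_Psi] show ?thesis
    by (simp add: o_def gauss_phi_imaginary)
qed

lemma has_real_derivative_erfi_half [derivative_intros]:
  assumes "(g has_real_derivative d) (at x within A)"
  shows "((\<lambda>x. erfi_half (g x)) has_real_derivative exp ((g x)\<^sup>2 / 2) * d) (at x within A)"
proof -
  have "(erfi_half has_real_derivative exp (y\<^sup>2 / 2)) (at y)" for y
  proof -
    have "((\<lambda>y. Im (Psi (\<i> * complex_of_real y))) has_vector_derivative
        Im (- \<i> * complex_of_real (exp (y\<^sup>2 / 2) / sqrt (2 * pi)))) (at y)"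
      by (rule bounded_linear.has_vector_derivative[OF bounded_linear_Im has_vector_derivative_Psi_imaginary])
    then have "((\<lambda>y. Im (Psi (\<i> * complex_of_real y))) has_real_derivative
        - (exp (y\<^sup>2 / 2) / sqrt (2 * pi))) (at y)"
      by (simp add: has_real_derivative_iff_has_vector_derivative)
    from DERIV_cmult[OF this, of "- sqrt (2 * pi)"] show ?thesis
      by (simp add: erfi_half_def[abs_def])
  qed
  from DERIV_chain2[OF this assms] show ?thesis .
qed

lemma erfi_half_0 [simp]: "erfi_half 0 = 0"
  by (simp add: erfi_half_def Psi_0)

lemma erfi_half_minus: "erfi_half (- y) = - erfi_half y"
proof -
  have "((\<lambda>y. erfi_half y + erfi_half (- y)) has_real_derivative 0) (at t)" for t
    by (auto intro!: derivative_eq_intros)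
  from DERIV_isconst_all[of "\<lambda>y. erfi_half y + erfi_half (- y)", OF allI[OF this], of y 0] show ?thesis
    by simp
qed

lemma erfi_half_strict_mono: "x < y \<Longrightarrow> erfi_half x < erfi_half y"
  by (rule DERIV_pos_imp_increasing) (auto intro!: derivative_eq_intros exI)

lemma erfi_half_pos: "0 < y \<Longrightarrow> 0 < erfi_half y"
  using erfi_half_strict_mono[of 0 y] by simp

text \<open>On the imaginary axis \<open>gauss_phi\<close> is real while dz is imaginary, so only
  the imaginary part of \<open>Psi\<close> varies; the real part keeps its value 1 / 2 at the
  origin.\<close>

lemma Psi_imaginary:
  "Psi (\<i> * complex_of_real y) = Complex (1 / 2) (- erfi_half y / sqrt (2 * pi))"
proof -
  have "((\<lambda>y. Re (Psi (\<i> * complex_of_real y))) has_vector_derivative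
      Re (- \<i> * complex_of_real (exp (y\<^sup>2 / 2) / sqrt (2 * pi)))) (at y)" for y
    by (rule bounded_linear.has_vector_derivative[OF bounded_linear_Re has_vector_derivative_Psi_imaginary])
  then have "((\<lambda>y. Re (Psi (\<i> * complex_of_real y))) has_real_derivative 0) (at y)" for y
    by (simp add: has_real_derivative_iff_has_vector_derivative)
  from DERIV_isconst_all[OF allI[OF this], of y 0] show ?thesis
    by (simp add: Psi_0 complex_eq_iff erfi_half_def)
qed

text \<open>This is |S(iy)|^(-2), so minimising |S| on the axis means maximising this
  function.\<close>

definition boundary_fun :: "real \<Rightarrow> real" where
  "boundary_fun y = (y\<^sup>2 + 2 / pi) * (pi / 2 + (erfi_half y)\<^sup>2) * exp (- (y\<^sup>2))"

lemma boundary_fun_pos: "boundary_fun y > 0"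
proof -
  have "y\<^sup>2 + 2 / pi > 0" "pi / 2 + (erfi_half y)\<^sup>2 > 0"
    by (intro add_nonneg_pos add_pos_nonneg; simp)+
  then show ?thesis
    by (simp add: boundary_fun_def)
qed

lemma norm_S_ratio_imaginary:
  "cmod (S_ratio (\<i> * complex_of_real y)) = 1 / sqrt (boundary_fun y)"
proof -
  have 1: "(cmod (Psi (\<i> * complex_of_real y)))\<^sup>2 = (pi / 2 + (erfi_half y)\<^sup>2) / (2 * pi)"
    by (simp add: Psi_imaginary cmod_power2 power_divide field_simps)
  have 2: "(cmod (gauss_phi (\<i> * complex_of_real y)))\<^sup>2 = exp (y\<^sup>2) / (2 * pi)"
    by (simp add: gauss_phi_imaginary norm_divide power_divide flip: exp_double)
  have 3: "(cmod (\<i> * complex_of_real y + complex_of_real (sqrt (2 / pi))))\<^sup>2 = y\<^sup>2 + 2 / pi"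
    by (simp add: cmod_power2)
  have "(cmod (S_ratio (\<i> * complex_of_real y)))\<^sup>2 = 1 / boundary_fun y"
    unfolding S_ratio_def inv_mills_def norm_divide power_divide 1 2 3 boundary_fun_def
    by (simp add: exp_minus field_simps)
  then have "sqrt ((cmod (S_ratio (\<i> * complex_of_real y)))\<^sup>2) = sqrt (1 / boundary_fun y)"
    by simp
  then show ?thesis
    by (simp add: real_sqrt_divide)
qed

text \<open>The polynomial p truncates the power series of exp (- y^2 / 2) *
  \<open>erfi_half y\<close>, with coefficients (-1)^k / (2 k + 1)!!. Consecutive terms cancel in p'
  + y p = 1 - y^8 / 105, so the difference of the two sides has a nonnegative derivative.\<close>

lemma erfi_half_ge:
  assumes "0 \<le> y"
  shows "y * (1 - y\<^sup>2 / 3 + y ^ 4 / 15 - y ^ 6 / 105) * exp (y\<^sup>2 / 2) \<le> erfi_half y"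
proof -
  let ?f = "\<lambda>y. erfi_half y - y * (1 - y\<^sup>2 / 3 + y ^ 4 / 15 - y ^ 6 / 105) * exp (y\<^sup>2 / 2)"
  have "(?f has_real_derivative t ^ 8 / 105 * exp (t\<^sup>2 / 2)) (at t)" for t
    by (rule derivative_eq_intros refl | simp)+ (simp add: field_simps eval_nat_numeral)
  then have "\<exists>d. (?f has_real_derivative d) (at t) \<and> 0 \<le> d" for t
    by (metis (no_types, lifting) exp_ge_zero mult_nonneg_nonneg divide_nonneg_nonneg zero_le_even_power even_numeral zero_le_numeral)
  then have "?f 0 \<le> ?f y"
    by (intro DERIV_nonneg_imp_nondecreasing[OF assms])
  then show ?thesis
    by simp
qed

text \<open>
  With \<open>u = y\<^sup>2\<close> and \<open>a = 1 - 2 / pi\<close>, this polynomial is, up to a negative factor, the coefficient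
  of \<open>erfi_half y\<close> in the derivative of \<open>crit y / (y * (u - a))\<close>, see \<open>crit_ratio_strict_antimono\<close>.
\<close>

definition dawson_den :: "real \<Rightarrow> real \<Rightarrow> real" where
  "dawson_den a u = u ^ 3 - 2 * a * u\<^sup>2 + (a\<^sup>2 - a + 3) * u - a * (1 - a)"

section \<open>Rational lower bound for exp (- y^2 / 2) * \<open>erfi_half y\<close>\<close>

context
  fixes a :: real
  \<comment> \<open>The interval contains 1 - 2 / pi = 0.36338...\<close>
  assumes a: "0.3633 \<le> a" "a \<le> 0.3634"
begin

lemma a_quadratic_bounds: "2.7686 \<le> a\<^sup>2 - a + 3" "a * (1 - a) \<le> 0.2314" "0.2313 \<le> a * (1 - a)"
proof -
  \<comment> \<open>These products are 0.3634 * (1 - 0.3634) - a * (1 - a) and a * (1 - a) - 0.3633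
    * (1 - 0.3633).\<close>
  have "0 \<le> (0.3634 - a) * (1 - 0.3634 - a)" "0 \<le> (a - 0.3633) * (1 - 0.3633 - a)"
    using a by (intro mult_nonneg_nonneg; simp)+
  then show "2.7686 \<le> a\<^sup>2 - a + 3" "a * (1 - a) \<le> 0.2314" "0.2313 \<le> a * (1 - a)"
    by (simp_all add: algebra_simps power2_eq_square)
qed

text \<open>Each coefficient is replaced by its worst case over the interval for \<open>a\<close>,
  which leaves a cubic with fixed decimal coefficients.\<close>

lemma dawson_den_ge:
  assumes "0 \<le> u"
  shows "u ^ 3 - 0.7268 * u\<^sup>2 + 2.7686 * u - 0.2314 \<le> dawson_den a u"
proof -
  have "(2 * a) * u\<^sup>2 \<le> 0.7268 * u\<^sup>2" "2.7686 * u \<le> (a\<^sup>2 - a + 3) * u"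
    using a a_quadratic_bounds assms by (intro mult_right_mono; simp)+
  then show ?thesis
    using a_quadratic_bounds by (simp add: dawson_den_def)
qed

lemma dawson_den_pos:
  assumes "a \<le> u"
  shows "0 < dawson_den a u"
proof -
  have u: "0.3633 \<le> u" using a assms by simp
  \<comment> \<open>The term u (u - 0.3634)^2 absorbs the two leading terms of the cubic; the
    remaining linear function is positive from 0.3633 on.\<close>
  have "0 < u * (u - 0.3634)\<^sup>2 + ((2.7686 - 0.3634\<^sup>2) * u - 0.2314)"
    by (intro add_nonneg_pos) (use u in \<open>simp_all add: power2_eq_square\<close>)
  also have "\<dots> = u ^ 3 - 0.7268 * u\<^sup>2 + 2.7686 * u - 0.2314"
    by (simp add: algebra_simps power2_eq_square power3_eq_cube)
  finally have "0 < u ^ 3 - 0.7268 * u\<^sup>2 + 2.7686 * u - 0.2314" .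
  then show ?thesis
    using dawson_den_ge[of u] u by simp
qed

text \<open>
  The cubic on the right is the lower bound of \<open>erfi_half_ge\<close>; it is replaced by its affine
  minorant \<open>0.954 - 0.243 * u\<close> on \<open>[0, 9 / 4]\<close>.
\<close>

lemma rational_bound_small:
  assumes "a \<le> u" "u \<le> 9 / 4"
  shows "(u + 1 - a) * (u - a) < (1 - u / 3 + u\<^sup>2 / 15 - u ^ 3 / 105) * dawson_den a u"
proof -
  have u: "0.3633 \<le> u" using a assms by simp
  have cubic: "u ^ 3 \<le> 9 / 4 * u\<^sup>2"
    using assms u by (simp add: power2_eq_square power3_eq_cube mult_right_mono)
  \<comment> \<open>Bounding u^3 by 9 / 4 * u^2 reduces the claim about the affine minorant to a
    quadratic without real roots, here with its square completed.\<close>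
  have "0 < (u - 0.0903334 / 0.09047)\<^sup>2 + (0.092 / 0.09047 - (0.0903334 / 0.09047)\<^sup>2)"
    by (intro add_nonneg_pos) (simp_all add: power2_eq_square)
  then have "0.0903334 * u \<le> 0.046 + 0.045235 * u\<^sup>2"
    by (simp add: power2_eq_square algebra_simps)
  moreover have "0.954 - 0.243 * u \<le> 1 - u / 3 + s / 15 - c / 105"
    if "c \<le> 9 / 4 * s" "0 \<le> s" "0.0903334 * u \<le> 0.046 + 0.045235 * s" for s c
    using that u by simp
  ultimately have 1: "0.954 - 0.243 * u \<le> 1 - u / 3 + u\<^sup>2 / 15 - u ^ 3 / 105"
    using cubic zero_le_power2 by blast
  have 2: "0.4 \<le> 0.954 - 0.243 * u"
    using assms by simp
  have "(u + 1 - a) * (u - a) = u * u + (1 - 2 * a) * u - a * (1 - a)"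
    by (simp add: algebra_simps)
  also have "\<dots> \<le> u * u + 0.2734 * u - 0.2313"
    using a u a_quadratic_bounds by (intro diff_mono add_mono mult_right_mono) auto
  also have "\<dots> < (0.954 - 0.243 * u) * (u ^ 3 - 0.7268 * u\<^sup>2 + 2.7686 * u - 0.2314)"
  proof -
    \<comment> \<open>The same reduction shows that the cubic factor below is positive: 1.1306 -
      0.243 * 9 / 4 exceeds 0.5838.\<close>
    have "0 < (u - 2.3662 / 1.1676)\<^sup>2 + (2 * 2.424 / 1.1676 - (2.3662 / 1.1676)\<^sup>2)"
      by (intro add_nonneg_pos) (simp_all add: power2_eq_square)
    then have "2.3662 * u < 2.424 + 0.5838 * u\<^sup>2"
      by (simp add: power2_eq_square algebra_simps)
    moreover have "0 < 2.424 - 2.3662 * u + 1.1306 * s - 0.243 * c"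
      if "c \<le> 9 / 4 * s" "0 \<le> s" "2.3662 * u < 2.424 + 0.5838 * s" for s c
      using that by simp
    ultimately have "0 < u * (2.424 - 2.3662 * u + 1.1306 * u\<^sup>2 - 0.243 * u ^ 3)"
      using cubic u zero_le_power2 by (intro mult_pos_pos) (simp, blast)
    \<comment> \<open>The added polynomial holds the constant term and the rounding remainders; all
      its coefficients are positive, and the sum is exactly the difference of the two sides.\<close>
    then have "0 < u * (2.424 - 2.3662 * u + 1.1306 * u\<^sup>2 - 0.243 * u ^ 3)
        + (0.0105444 + 0.0000746 * u + 0.000063 * u\<^sup>2 + 0.0000124 * u ^ 3)"
      using u by (intro add_pos_nonneg add_nonneg_nonneg) auto
    also have "\<dots> = (0.954 - 0.243 * u) * (u ^ 3 - 0.7268 * u\<^sup>2 + 2.7686 * u - 0.2314)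
        - (u * u + 0.2734 * u - 0.2313)"
      by algebra
    finally show ?thesis
      by simp
  qed
  also have "\<dots> \<le> (0.954 - 0.243 * u) * dawson_den a u"
    using 2 u by (intro mult_left_mono dawson_den_ge) auto
  also have "\<dots> \<le> (1 - u / 3 + u\<^sup>2 / 15 - u ^ 3 / 105) * dawson_den a u"
    using 1 dawson_den_pos[of u] assms by (intro mult_right_mono) auto
  finally show ?thesis .
qed

lemma erfi_half_gt_small:
  assumes "0 < y" "a \<le> y\<^sup>2" "y \<le> 3 / 2"
  shows "y * ((y\<^sup>2 + 1 - a) * (y\<^sup>2 - a)) / dawson_den a (y\<^sup>2) * exp (y\<^sup>2 / 2) < erfi_half y"
proof -
  have "y\<^sup>2 \<le> (3 / 2)\<^sup>2"
    using assms by (intro power_mono) auto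
  then have "(y\<^sup>2 + 1 - a) * (y\<^sup>2 - a) / dawson_den a (y\<^sup>2)
      < 1 - y\<^sup>2 / 3 + (y\<^sup>2)\<^sup>2 / 15 - (y\<^sup>2) ^ 3 / 105"
    using rational_bound_small[OF assms(2)] dawson_den_pos[OF assms(2)]
    by (simp add: divide_less_eq power2_eq_square)
  from mult_strict_right_mono[OF mult_strict_left_mono[OF this \<open>0 < y\<close>], of "exp (y\<^sup>2 / 2)"]
  show ?thesis
    using erfi_half_ge[of y] assms(1) by (simp flip: power_mult)
qed

text \<open>Dividing by \<open>dawson_den\<close> gives \<open>erfi_half\<close> the constant
  coefficient 1, so the derivative of \<open>?V\<close> is exp (t^2 / 2) times a rational function.
  It is nonnegative from 3 / 2 on, and up to 3 / 2 the bound is already known.\<close>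

lemma erfi_half_gt:
  assumes "0 < y" "a \<le> y\<^sup>2"
  shows "y * ((y\<^sup>2 + 1 - a) * (y\<^sup>2 - a)) * exp (y\<^sup>2 / 2) < erfi_half y * dawson_den a (y\<^sup>2)"
proof -
  let ?N = "\<lambda>y. y * ((y\<^sup>2 + 1 - a) * (y\<^sup>2 - a))"
  let ?W = "\<lambda>y. dawson_den a (y\<^sup>2)"
  let ?V = "\<lambda>y. erfi_half y - ?N y / ?W y * exp (y\<^sup>2 / 2)"
  have "0 < ?V y"
  proof (cases "y \<le> 3 / 2")
    case True
    then show ?thesis
      using erfi_half_gt_small[OF assms] by simp
  next
    case False
    \<comment> \<open>\<open>?V\<close> decreases until about \<open>y = 1.4\<close> and increases afterwards, hence the split at \<open>3 / 2\<close>.\<close>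
    have "\<exists>d. (?V has_real_derivative d) (at t) \<and> 0 \<le> d" if t: "3 / 2 \<le> t" for t
    proof -
      let ?u = "t\<^sup>2"
      define N' where "N' = (?u + 1 - a) * (?u - a) + 2 * ?u * (2 * ?u + 1 - 2 * a)"
      define W' where "W' = 2 * t * (3 * ?u\<^sup>2 - 4 * a * ?u + (a\<^sup>2 - a + 3))"
      have u: "9 / 4 \<le> ?u"
        using power_mono[OF t, of 2] by (simp add: power2_eq_square)
      then have W: "0 < ?W t"
        using a by (intro dawson_den_pos) simp
      have N': "(?N has_real_derivative N') (at t)"
        unfolding N'_def by (auto intro!: derivative_eq_intros simp: algebra_simps power2_eq_square)
      have W': "(?W has_real_derivative W') (at t)"
        unfolding W'_def dawson_den_def
        by (auto intro!: derivative_eq_intros simp: algebra_simps power2_eq_square power3_eq_cube)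
      have der: "(?V has_real_derivative
          exp (?u / 2) * ((?W t)\<^sup>2 - N' * ?W t + ?N t * W' - t * ?N t * ?W t) / (?W t)\<^sup>2) (at t)"
      proof -
        have "(?V has_real_derivative exp (?u / 2) * 1 -
           ((N' * ?W t - ?N t * W') / (?W t * ?W t) * exp (?u / 2) + exp (?u / 2) * t * (?N t / ?W t))) (at t)"
          by (intro DERIV_diff DERIV_mult DERIV_divide N' W' has_real_derivative_erfi_half DERIV_ident)
             (use W in \<open>auto intro!: derivative_eq_intros\<close>)
        moreover have "e * 1 - ((n' * w - n * w') / (w * w) * e + e * t * (n / w))
            = e * (w\<^sup>2 - n' * w + n * w' - t * n * w) / w\<^sup>2" if "w \<noteq> 0" for e n n' w w' :: real
          using that by (simp add: field_simps power2_eq_square)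
        ultimately show ?thesis
          using W by simp
      qed
      \<comment> \<open>With u = t^2, the powers u^6 and u^5 and the constant term cancel.\<close>
      have num: "(?W t)\<^sup>2 - N' * ?W t + ?N t * W' - t * ?N t * ?W t
        = ?u * ((6 - 2 * a) * ?u ^ 3 + (- 12 - 10 * a + 6 * a\<^sup>2) * ?u\<^sup>2
            + (6 + 10 * a + 2 * a\<^sup>2 - 6 * a ^ 3) * ?u + (- 6 * a + 2 * a\<^sup>2 + 2 * a ^ 3 + 2 * a ^ 4))"
        unfolding N'_def W'_def dawson_den_def by algebra
      have "0 \<le> (6 - 2 * a) * ?u ^ 3 + (- 12 - 10 * a + 6 * a\<^sup>2) * ?u\<^sup>2
            + (6 + 10 * a + 2 * a\<^sup>2 - 6 * a ^ 3) * ?u + (- 6 * a + 2 * a\<^sup>2 + 2 * a ^ 3 + 2 * a ^ 4)"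
      proof -
        have powers: "0.3633\<^sup>2 \<le> a\<^sup>2" "a ^ 3 \<le> 0.3634 ^ 3"
          using a by (intro power_mono; simp)+
        have c3: "5.27 * ?u ^ 3 \<le> (6 - 2 * a) * ?u ^ 3"
          using a u by (intro mult_right_mono) auto
        have c2: "- 14.9 * ?u\<^sup>2 \<le> (- 12 - 10 * a + 6 * a\<^sup>2) * ?u\<^sup>2"
          using powers a u by (intro mult_right_mono; simp add: power_divide)
        have c1: "9.4 * ?u \<le> (6 + 10 * a + 2 * a\<^sup>2 - 6 * a ^ 3) * ?u"
          using powers a u by (intro mult_right_mono; simp add: power_divide)
        have c0: "- 1.95 \<le> - 6 * a + 2 * a\<^sup>2 + 2 * a ^ 3 + 2 * a ^ 4"
        proof -
          have "0 \<le> a ^ 3" "0 \<le> a ^ 4"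
            using a by simp_all
          with powers(1) a have "- 1.95 + 0 + 0 \<le> (- 6 * a + 2 * a\<^sup>2) + 2 * a ^ 3 + 2 * a ^ 4"
            by (intro add_mono) (simp_all add: power_divide)
          then show ?thesis by simp
        qed
        \<comment> \<open>The first fact bounds u^3 below by a quadratic, the second bounds u^2
          below by 9 / 4 * u; a linear inequality remains.\<close>
        have "0 \<le> ?u * (?u - 9 / 4)\<^sup>2" "9 / 4 * ?u \<le> ?u * ?u"
          using u by (intro mult_nonneg_nonneg mult_right_mono; simp)+
        then have "0 \<le> 5.27 * ?u ^ 3 + - 14.9 * ?u\<^sup>2 + 9.4 * ?u + - 1.95"
          using u by (simp only: power2_diff) (simp add: power2_eq_square power3_eq_cube algebra_simps)
        also have "\<dots> \<le> (6 - 2 * a) * ?u ^ 3 + (- 12 - 10 * a + 6 * a\<^sup>2) * ?u\<^sup>2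
            + (6 + 10 * a + 2 * a\<^sup>2 - 6 * a ^ 3) * ?u + (- 6 * a + 2 * a\<^sup>2 + 2 * a ^ 3 + 2 * a ^ 4)"
          by (intro add_mono c0 c1 c2 c3)
        finally show ?thesis .
      qed
      then have "0 \<le> (?W t)\<^sup>2 - N' * ?W t + ?N t * W' - t * ?N t * ?W t"
        unfolding num by (rule mult_nonneg_nonneg[OF zero_le_power2])
      then have nonneg: "0 \<le> exp (?u / 2) * ((?W t)\<^sup>2 - N' * ?W t + ?N t * W' - t * ?N t * ?W t) / (?W t)\<^sup>2"
        by (rule divide_nonneg_nonneg[OF mult_nonneg_nonneg[OF exp_ge_zero] zero_le_power2])
      show ?thesis
        by (rule exI, rule conjI, rule der, rule nonneg)
    qed
    then have "?V (3 / 2) \<le> ?V y"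
      using DERIV_nonneg_imp_nondecreasing[of "3 / 2" y ?V] False by (meson linear)
    moreover have "0 < ?V (3 / 2)"
      using erfi_half_gt_small[of "3 / 2"] a by (simp add: power2_eq_square)
    ultimately show ?thesis
      by simp
  qed
  then show ?thesis
    using dawson_den_pos[OF assms(2)] by (simp add: field_simps)
qed

end

section \<open>Numerical bounds\<close>

text \<open>Lagrange remainder; the factor 6 comes from exp (3 / 2) = exp 1 * exp (1 / 2) <= 3 *
  2.\<close>

lemma exp_taylor_bounds:
  fixes x :: real
  assumes "0 \<le> x" "x \<le> 3 / 2"
  shows "(\<Sum>m<n. x ^ m / fact m) \<le> exp x" "exp x \<le> (\<Sum>m<n. x ^ m / fact m) + 6 * (x ^ n / fact n)"
proof -
  obtain t where t: "\<bar>t\<bar> \<le> \<bar>x\<bar>" "exp x = (\<Sum>m<n. x ^ m / fact m) + exp t / fact n * x ^ n"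
    using Maclaurin_exp_le by blast
  have "exp t \<le> exp (1 + 1 / 2)"
    using t assms by simp
  also have "\<dots> \<le> 3 * (1 + 2 * (1 / 2))"
    unfolding exp_add by (intro mult_mono real_exp_bound_lemma exp_le) auto
  finally have "exp t / fact n * x ^ n \<le> 6 / fact n * x ^ n"
    using assms by (intro mult_right_mono divide_right_mono) auto
  then show "exp x \<le> (\<Sum>m<n. x ^ m / fact m) + 6 * (x ^ n / fact n)"
    using t by simp
  show "(\<Sum>m<n. x ^ m / fact m) \<le> exp x"
    using t assms by simp
qed

text \<open>These are the bounds for exp (t^2 / 2) integrated term by term, carried out by comparing
  derivatives; y^2 <= 3 keeps the argument t^2 / 2 below 3 / 2.\<close>

lemma erfi_half_taylor_bounds:
  assumes "0 \<le> y" "y\<^sup>2 \<le> 3"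
  shows "(\<Sum>m<n. y ^ (2 * m + 1) / (2 ^ m * fact m * (2 * real m + 1))) \<le> erfi_half y"
    and "erfi_half y \<le> (\<Sum>m<n. y ^ (2 * m + 1) / (2 ^ m * fact m * (2 * real m + 1)))
      + 6 * (y ^ (2 * n + 1) / (2 ^ n * fact n * (2 * real n + 1)))"
proof -
  have term_deriv: "((\<lambda>y. y ^ (2 * m + 1) / (2 ^ m * fact m * (2 * real m + 1))) has_real_derivative
      (t\<^sup>2 / 2) ^ m / fact m) (at t)" for m t
  proof -
    have "((\<lambda>y. y ^ (2 * m + 1) / (2 ^ m * fact m * (2 * real m + 1))) has_real_derivative
        (2 * real m + 1) * t ^ (2 * m) / (2 ^ m * fact m * (2 * real m + 1))) (at t)"
      by (rule DERIV_cdivide) (use DERIV_pow[of "2 * m + 1" t UNIV] in \<open>simp add: algebra_simps\<close>)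
    moreover have "(2 * real m + 1) * t ^ (2 * m) / (2 ^ m * fact m * (2 * real m + 1)) = (t\<^sup>2 / 2) ^ m / fact m"
    proof -
      have "2 * real m + 1 \<noteq> 0"
        by linarith
      then show ?thesis
        by (simp add: power_mult power_divide)
    qed
    ultimately show ?thesis
      by simp
  qed
  let ?s = "\<lambda>y. \<Sum>m<n. y ^ (2 * m + 1) / (2 ^ m * fact m * (2 * real m + 1))"
  let ?r = "\<lambda>y. y ^ (2 * n + 1) / (2 ^ n * fact n * (2 * real n + 1))"
  have small: "t\<^sup>2 / 2 \<le> 3 / 2" if "0 \<le> t" "t \<le> y" for t
    using power_mono[OF that(2,1), of 2] assms by simp
  have "erfi_half 0 - ?s 0 \<le> erfi_half y - ?s y"
  proof (rule DERIV_nonneg_imp_nondecreasing[OF assms(1)])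
    fix t assume "0 \<le> t" "t \<le> y"
    have der: "((\<lambda>y. erfi_half y - ?s y) has_real_derivative
        exp (t\<^sup>2 / 2) * 1 - (\<Sum>m<n. (t\<^sup>2 / 2) ^ m / fact m)) (at t)"
      by (intro DERIV_diff DERIV_sum term_deriv has_real_derivative_erfi_half DERIV_ident)
    have nonneg: "0 \<le> exp (t\<^sup>2 / 2) * 1 - (\<Sum>m<n. (t\<^sup>2 / 2) ^ m / fact m)"
      using exp_taylor_bounds(1)[of "t\<^sup>2 / 2" n] small[OF \<open>0 \<le> t\<close> \<open>t \<le> y\<close>]
      by simp
    show "\<exists>d. ((\<lambda>y. erfi_half y - ?s y) has_real_derivative d) (at t) \<and> 0 \<le> d"
      by (rule exI, rule conjI, rule der, rule nonneg)
  qed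
  then show "?s y \<le> erfi_half y"
    by simp
  have "?s 0 + 6 * ?r 0 - erfi_half 0 \<le> ?s y + 6 * ?r y - erfi_half y"
  proof (rule DERIV_nonneg_imp_nondecreasing[OF assms(1)])
    fix t assume "0 \<le> t" "t \<le> y"
    have der: "((\<lambda>y. ?s y + 6 * ?r y - erfi_half y) has_real_derivative
        (\<Sum>m<n. (t\<^sup>2 / 2) ^ m / fact m) + 6 * ((t\<^sup>2 / 2) ^ n / fact n) - exp (t\<^sup>2 / 2) * 1) (at t)"
      by (intro DERIV_diff DERIV_add DERIV_cmult DERIV_sum term_deriv has_real_derivative_erfi_half DERIV_ident)
    have nonneg: "0 \<le> (\<Sum>m<n. (t\<^sup>2 / 2) ^ m / fact m) + 6 * ((t\<^sup>2 / 2) ^ n / fact n) - exp (t\<^sup>2 / 2) * 1"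
      using exp_taylor_bounds(2)[of "t\<^sup>2 / 2" n] small[OF \<open>0 \<le> t\<close> \<open>t \<le> y\<close>]
      by simp
    show "\<exists>d. ((\<lambda>y. ?s y + 6 * ?r y - erfi_half y) has_real_derivative d) (at t) \<and> 0 \<le> d"
      by (rule exI, rule conjI, rule der, rule nonneg)
  qed
  then show "erfi_half y \<le> ?s y + 6 * ?r y"
    by simp
qed

text \<open>With twelve terms the remainder is below 4 * 10^(-7), enough for enclosures of width
  10^(-6).\<close>

lemma exp_at_bracket:
  "3.754955 \<le> exp (1.6267\<^sup>2 / 2 :: real)" "exp (1.6267\<^sup>2 / 2 :: real) \<le> 3.754956"
  "3.755566 \<le> exp (1.6268\<^sup>2 / 2 :: real)" "exp (1.6268\<^sup>2 / 2 :: real) \<le> 3.755567"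
  by (rule order_trans[OF _ exp_taylor_bounds(1)[where n = 12]]
        order_trans[OF exp_taylor_bounds(2)[where n = 12]];
      simp add: lessThan_nat_numeral fact_numeral power_divide)+

lemma erfi_half_at_bracket:
  "2.747764 \<le> erfi_half 1.6267" "erfi_half 1.6267 \<le> 2.747765"
  "2.748139 \<le> erfi_half 1.6268" "erfi_half 1.6268 \<le> 2.748140"
  by (rule order_trans[OF _ erfi_half_taylor_bounds(1)[where n = 12]]
        order_trans[OF erfi_half_taylor_bounds(2)[where n = 12]];
      simp add: lessThan_nat_numeral fact_numeral power_divide)+

section \<open>The maximum of the boundary function\<close>

text \<open>This is the derivative of \<open>boundary_fun\<close> without the positive factor 2 exp
  (- y^2). The term with 1 - 2 / pi stems from differentiating (y^2 + 2 / pi) exp (- y^2).\<close>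

definition crit :: "real \<Rightarrow> real" where
  "crit y = (y\<^sup>2 + 2 / pi) * erfi_half y * exp (y\<^sup>2 / 2)
     - y * (y\<^sup>2 - (1 - 2 / pi)) * (pi / 2 + (erfi_half y)\<^sup>2)"

lemma DERIV_boundary_fun: "(boundary_fun has_real_derivative 2 * exp (- (y\<^sup>2)) * crit y) (at y)"
proof -
  have "((\<lambda>y. (y\<^sup>2 + 2 / pi) * (pi / 2 + (erfi_half y)\<^sup>2) * exp (- (y\<^sup>2))) has_real_derivative
      (2 * y * (pi / 2 + (erfi_half y)\<^sup>2) + 2 * erfi_half y * exp (y\<^sup>2 / 2) * (y\<^sup>2 + 2 / pi)) * exp (- (y\<^sup>2))
      + - (2 * y) * exp (- (y\<^sup>2)) * ((y\<^sup>2 + 2 / pi) * (pi / 2 + (erfi_half y)\<^sup>2))) (at y)"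
    by (intro DERIV_mult) (auto intro!: derivative_eq_intros)
  moreover have "(2 * y * A + 2 * E * e * (y\<^sup>2 + b)) * X + - (2 * y) * X * ((y\<^sup>2 + b) * A)
      = 2 * X * ((y\<^sup>2 + b) * E * e - y * (y\<^sup>2 - (1 - b)) * A)" for A E e X b :: real
    by (simp add: algebra_simps)
  ultimately show ?thesis
    by (simp add: boundary_fun_def[abs_def] crit_def)
qed

lemma two_div_pi_bounds: "0.636619 \<le> 2 / pi" "2 / pi \<le> 0.63662"
  using pi_approx by (simp_all add: field_simps)

lemma crit_at_bracket: "0 < crit 1.6267" "crit 1.6268 < 0"
proof -
  have pi2: "1.5707963 \<le> pi / 2" "pi / 2 \<le> 1.5707964"
    using pi_approx by simp_all
  have "1.6267 * (1.6267\<^sup>2 - (1 - 2 / pi)) * (pi / 2 + (erfi_half 1.6267)\<^sup>2)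
      \<le> 1.6267 * (1.6267\<^sup>2 - (1 - 0.63662)) * (1.5707964 + 2.747765\<^sup>2)"
    using two_div_pi_bounds pi2 erfi_half_at_bracket
    by (intro mult_mono add_mono power_mono) (simp_all add: power_divide)
  also have "\<dots> < (1.6267\<^sup>2 + 0.636619) * 2.747764 * 3.754955"
    by (simp add: power_divide)
  also have "\<dots> \<le> (1.6267\<^sup>2 + 2 / pi) * erfi_half 1.6267 * exp (1.6267\<^sup>2 / 2)"
    using two_div_pi_bounds erfi_half_at_bracket exp_at_bracket
    by (intro mult_mono add_mono) (simp_all add: power_divide)
  finally show "0 < crit 1.6267"
    by (simp add: crit_def)
  have "(1.6268\<^sup>2 + 2 / pi) * erfi_half 1.6268 * exp (1.6268\<^sup>2 / 2)
      \<le> (1.6268\<^sup>2 + 0.63662) * 2.748140 * 3.755567"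
    using two_div_pi_bounds erfi_half_at_bracket exp_at_bracket
    by (intro mult_mono add_mono) (simp_all add: power_divide)
  also have "\<dots> < 1.6268 * (1.6268\<^sup>2 - (1 - 0.636619)) * (1.5707963 + 2.748139\<^sup>2)"
    by (simp add: power_divide)
  also have "\<dots> \<le> 1.6268 * (1.6268\<^sup>2 - (1 - 2 / pi)) * (pi / 2 + (erfi_half 1.6268)\<^sup>2)"
    using two_div_pi_bounds pi2 erfi_half_at_bracket
    by (intro mult_mono add_mono power_mono) (simp_all add: power_divide)
  finally show "crit 1.6268 < 0"
    by (simp add: crit_def)
qed

text \<open>This covers the range where the divisor in \<open>crit_ratio_strict_antimono\<close> is
  not positive.\<close>

lemma crit_pos_small:
  assumes "0 < y" "y\<^sup>2 \<le> 1 - 2 / pi"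
  shows "0 < crit y"
proof -
  have "y * (y\<^sup>2 - (1 - 2 / pi)) * (pi / 2 + (erfi_half y)\<^sup>2) \<le> 0"
    using assms by (intro mult_nonpos_nonneg mult_nonneg_nonpos) auto
  moreover have "0 < (y\<^sup>2 + 2 / pi) * erfi_half y * exp (y\<^sup>2 / 2)"
    using erfi_half_pos[OF assms(1)] by (intro mult_pos_pos add_nonneg_pos) auto
  ultimately show ?thesis
    by (simp add: crit_def)
qed

text \<open>The division gives pi / 2 + E^2, with E = \<open>erfi_half\<close>, a constant
  coefficient. The derivative then has no E^2 left and factors into an exponential and an expression
  linear in E, whose sign is \<open>erfi_half_gt\<close>.\<close>

lemma crit_ratio_strict_antimono:
  assumes "0 < x" "1 - 2 / pi < x\<^sup>2" "x < y"
  shows "crit y / (y * (y\<^sup>2 - (1 - 2 / pi))) < crit x / (x * (x\<^sup>2 - (1 - 2 / pi)))"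
proof -
  define a where "a = 1 - 2 / pi"
  have a: "0.3633 \<le> a" "a \<le> 0.3634"
    using two_div_pi_bounds by (simp_all add: a_def)
  let ?q = "\<lambda>t. (t\<^sup>2 + 1 - a) / (t * (t\<^sup>2 - a))"
  let ?L = "\<lambda>t. ?q t * (erfi_half t * exp (t\<^sup>2 / 2)) - (pi / 2 + (erfi_half t)\<^sup>2)"
  have range: "0 < t" "a < t\<^sup>2" if "x \<le> t" for t
    using assms less_le_trans[OF assms(2) power_mono[OF that, of 2]] that by (auto simp: a_def)
  have L: "crit t / (t * (t\<^sup>2 - (1 - 2 / pi))) = ?L t" if "x \<le> t" for t
  proof -
    have "(n * E * e - d * P) / d = n / d * (E * e) - P" if "d \<noteq> 0" for n E e d P :: real
      using that by (simp add: field_simps)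
    from this[of "t * (t\<^sup>2 - a)" "t\<^sup>2 + 1 - a"] range[OF that] show ?thesis
      by (simp add: crit_def a_def)
  qed
  have "?L y < ?L x"
  proof (rule DERIV_neg_imp_decreasing[OF assms(3)])
    fix t assume "x \<le> t" "t \<le> y"
    note t = range[OF \<open>x \<le> t\<close>]
    let ?u = "t\<^sup>2" and ?E = "erfi_half t" and ?e = "exp (t\<^sup>2 / 2)"
    let ?d = "t * (?u - a)"
    let ?q' = "(2 * t * ?d - (?u + 1 - a) * (3 * ?u - a)) / (?d * ?d)"
    have d: "0 < ?d" "?d \<noteq> 0"
      using t by simp_all
    have "((\<lambda>t. t * (t\<^sup>2 - a)) has_real_derivative (3 * ?u - a)) (at t)"
      by (auto intro!: derivative_eq_intros simp: power2_eq_square algebra_simps)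
    then have q': "(?q has_real_derivative ?q') (at t)"
      using d by (intro DERIV_divide) (auto intro!: derivative_eq_intros)
    have der: "(?L has_real_derivative (?q' * (?E * ?e) + (?e * ?e + ?e * t * ?E) * ?q t - (0 + 2 * ?E * ?e))) (at t)"
      by (intro DERIV_diff DERIV_mult q' DERIV_add DERIV_const) (auto intro!: derivative_eq_intros)
    have "?q' * (?E * ?e) + (?e * ?e + ?e * t * ?E) * ?q t - (0 + 2 * ?E * ?e)
        = - (?e * (?E * dawson_den a ?u - t * ((?u + 1 - a) * (?u - a)) * ?e) / (?d * ?d))"
    proof -
      have "n' / (d * d) * (E * e) + (e * e + e * s * E) * (n / d) - (0 + 2 * E * e)
          = (n' * E * e + (e * e + e * s * E) * n * d - 2 * E * e * d * d) / (d * d)"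
        if "d \<noteq> 0" for n n' d E e s :: real
        using that by (simp add: field_simps)
      from this[OF d(2)] have "?q' * (?E * ?e) + (?e * ?e + ?e * t * ?E) * ?q t - (0 + 2 * ?E * ?e)
        = ((2 * t * ?d - (?u + 1 - a) * (3 * ?u - a)) * ?E * ?e
            + (?e * ?e + ?e * t * ?E) * (?u + 1 - a) * ?d - 2 * ?E * ?e * ?d * ?d) / (?d * ?d)"
        .
      also have "(2 * t * ?d - (?u + 1 - a) * (3 * ?u - a)) * ?E * ?e
            + (?e * ?e + ?e * t * ?E) * (?u + 1 - a) * ?d - 2 * ?E * ?e * ?d * ?d
          = - (?e * (?E * dawson_den a ?u - t * ((?u + 1 - a) * (?u - a)) * ?e))"
        unfolding dawson_den_def by algebra
      finally show ?thesis
        by simp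
    qed
    also have "\<dots> < 0"
      using erfi_half_gt[OF a t(1)] t(2) d
      by (auto simp del: mult_pos_pos intro!: divide_pos_pos mult_pos_pos)
    finally have neg: "?q' * (?E * ?e) + (?e * ?e + ?e * t * ?E) * ?q t - (0 + 2 * ?E * ?e) < 0" .
    show "\<exists>d. (?L has_real_derivative d) (at t) \<and> d < 0"
      by (rule exI, rule conjI, rule der, rule neg)
  qed
  then show ?thesis
    using L[of x] L[of y] assms by simp
qed

text \<open>The intermediate value theorem gives a zero. There the strictly decreasing quotient
  vanishes too, which fixes its sign, and that of \<open>crit\<close>, on both sides as long as the
  divisor is positive.\<close>

lemma crit_sign_change:
  obtains ystar where "1.6267 < ystar" "ystar < 1.6268"
    "\<And>y. 0 < y \<Longrightarrow> y < ystar \<Longrightarrow> 0 < crit y" "\<And>y. ystar < y \<Longrightarrow> crit y < 0"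
proof -
  have "continuous_on {1.6267..1.6268} crit"
    unfolding crit_def[abs_def]
    by (intro DERIV_atLeastAtMost_imp_continuous_on) (auto intro!: derivative_eq_intros exI)
  then obtain ystar where ystar: "1.6267 \<le> ystar" "ystar \<le> 1.6268" "crit ystar = 0"
    using IVT2'[of crit "1.6268" 0 "1.6267"] crit_at_bracket by auto
  have a: "1 - 2 / pi \<le> 1"
    by simp
  have "0 < crit y" if "0 < y" "y < ystar" for y
  proof (cases "y\<^sup>2 \<le> 1 - 2 / pi")
    case True
    with crit_pos_small that show ?thesis by simp
  next
    case False
    then have "0 < crit y / (y * (y\<^sup>2 - (1 - 2 / pi)))"
      using crit_ratio_strict_antimono[of y ystar] ystar(3) that by simp
    moreover have "0 < y * (y\<^sup>2 - (1 - 2 / pi))"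
      using False that by simp
    ultimately show ?thesis
      by (simp only: zero_less_divide_iff) auto
  qed
  moreover have "crit y < 0" if "ystar < y" for y
  proof -
    have "1 < ystar\<^sup>2"
      using ystar by (intro one_less_power) auto
    then have "1 - 2 / pi < ystar\<^sup>2"
      using a by linarith
    moreover have "ystar\<^sup>2 \<le> y\<^sup>2"
      using that ystar by (intro power_mono) auto
    moreover from calculation have "1 - 2 / pi < y\<^sup>2"
      by linarith
    ultimately have "crit y / (y * (y\<^sup>2 - (1 - 2 / pi))) < 0" "0 < y * (y\<^sup>2 - (1 - 2 / pi))"
      using crit_ratio_strict_antimono[of ystar y] ystar that by (auto intro!: mult_pos_pos)
    then show ?thesis
      by (simp only: divide_less_0_iff) auto
  qed
  moreover have "ystar \<noteq> 1.6267" "ystar \<noteq> 1.6268"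
    using ystar(3) crit_at_bracket by (metis less_irrefl)+
  ultimately show ?thesis
    using that[of ystar] ystar(1,2) by fastforce
qed

lemma boundary_fun_0 [simp]: "boundary_fun 0 = 1"
  by (simp add: boundary_fun_def)

lemma boundary_fun_minus: "boundary_fun (- y) = boundary_fun y"
  by (simp add: boundary_fun_def erfi_half_minus)

text \<open>The targets are 1 / 0.687^2 = 2.11878... and 1 / 0.686^2 = 2.12496...; the upper bound
  leaves room for the growth from 1.6267 to the maximiser.\<close>

lemma boundary_fun_at_bracket: "2.119 \<le> boundary_fun 1.6267" "boundary_fun 1.6267 \<le> 2.1237"
proof -
  have exp: "exp (- (1.6267\<^sup>2)) = 1 / (exp (1.6267\<^sup>2 / 2 :: real))\<^sup>2"
    by (simp add: exp_minus inverse_eq_divide power2_eq_square flip: exp_add)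
  have pi2: "1.5707963 \<le> pi / 2" "pi / 2 \<le> 1.5707964"
    using pi_approx by simp_all
  have "boundary_fun 1.6267 \<le> (1.6267\<^sup>2 + 0.63662) * (1.5707964 + 2.747765\<^sup>2) * (1 / 3.754955\<^sup>2)"
    unfolding boundary_fun_def exp
    using two_div_pi_bounds erfi_half_at_bracket exp_at_bracket pi2
    by (intro mult_mono add_mono power_mono divide_left_mono) (simp_all add: power_divide)
  also have "\<dots> \<le> 2.1237"
    by (simp add: power_divide)
  finally show "boundary_fun 1.6267 \<le> 2.1237" .
  have "2.119 \<le> (1.6267\<^sup>2 + 0.636619) * (1.5707963 + 2.747764\<^sup>2) * (1 / 3.754956\<^sup>2 :: real)"
    by (simp add: power_divide)
  also have "\<dots> \<le> boundary_fun 1.6267"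
    unfolding boundary_fun_def exp
    using two_div_pi_bounds erfi_half_at_bracket exp_at_bracket pi2
    by (intro mult_mono add_mono power_mono divide_left_mono) (simp_all add: power_divide)
  finally show "2.119 \<le> boundary_fun 1.6267" .
qed

lemma boundary_fun_unimodal:
  obtains ystar where "1.6267 < ystar" "ystar < 1.6268"
    "\<And>x y. 0 \<le> x \<Longrightarrow> x < y \<Longrightarrow> y \<le> ystar \<Longrightarrow> boundary_fun x < boundary_fun y"
    "\<And>x y. ystar \<le> x \<Longrightarrow> x < y \<Longrightarrow> boundary_fun y < boundary_fun x"
    "2.119 < boundary_fun ystar" "boundary_fun ystar < 2.1248"
proof -
  obtain ystar where ystar: "1.6267 < ystar" "ystar < 1.6268"
    and pos: "\<And>y. 0 < y \<Longrightarrow> y < ystar \<Longrightarrow> 0 < crit y" and neg: "\<And>y. ystar < y \<Longrightarrow> crit y < 0"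
    using crit_sign_change by blast
  have cont: "continuous_on A boundary_fun" for A
    using DERIV_isCont[OF DERIV_boundary_fun] by (auto intro: continuous_at_imp_continuous_on)
  have mono: "boundary_fun x < boundary_fun y" if "0 \<le> x" "x < y" "y \<le> ystar" for x y
    using that pos DERIV_boundary_fun
    by (intro DERIV_pos_imp_increasing_open[OF that(2) _ cont])
       (metis exp_gt_zero less_le_trans order.strict_trans1 mult_pos_pos zero_less_numeral)
  moreover have "boundary_fun y < boundary_fun x" if "ystar \<le> x" "x < y" for x y
    using that neg DERIV_boundary_fun
    by (intro DERIV_neg_imp_decreasing_open[OF that(2) _ cont])
       (metis exp_gt_zero le_less_trans mult_pos_neg mult_pos_pos zero_less_numeral)
  moreover have "2.119 < boundary_fun ystar"
    using mono[of "1.6267" ystar] ystar boundary_fun_at_bracket by simp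
  \<comment> \<open>Mean value theorem on an interval shorter than 0.0001: dropping the subtracted
    term of \<open>crit\<close> gives the crude slope bound 6.2, hence a growth of at most
    0.00062.\<close>
  moreover have "boundary_fun ystar < 2.1248"
  proof -
    obtain t where t: "1.6267 < t" "t < ystar"
      "boundary_fun ystar - boundary_fun 1.6267 = (ystar - 1.6267) * (2 * exp (- (t\<^sup>2)) * crit t)"
      using MVT2[OF ystar(1) DERIV_boundary_fun] by blast
    have "1.6267\<^sup>2 / 2 \<le> t\<^sup>2 / 2"
      using t by (intro divide_right_mono power_mono) auto
    then have "exp (1.6267\<^sup>2 / 2) \<le> exp (t\<^sup>2 / 2)"
      by (rule exp_le_cancel_iff[THEN iffD2])
    from order_trans[OF exp_at_bracket(1) this] have "3 \<le> exp (t\<^sup>2 / 2)"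
      by simp
    then have exp_half: "exp (- (t\<^sup>2 / 2)) \<le> 1 / 3"
      unfolding exp_minus inverse_eq_divide by (intro divide_left_mono) auto
    have "0 \<le> t * (t\<^sup>2 - (1 - 2 / pi)) * (pi / 2 + (erfi_half t)\<^sup>2)"
    proof (intro mult_nonneg_nonneg)
      have "1 \<le> t\<^sup>2"
        using t by (intro one_le_power) simp
      moreover have "1 - 2 / pi \<le> 1"
        by simp
      ultimately show "0 \<le> t\<^sup>2 - (1 - 2 / pi)"
        by linarith
    qed (use t in auto)
    then have "exp (- (t\<^sup>2)) * crit t \<le> exp (- (t\<^sup>2)) * ((t\<^sup>2 + 2 / pi) * erfi_half t * exp (t\<^sup>2 / 2))"
      by (intro mult_left_mono) (auto simp: crit_def)
    also have "\<dots> = (t\<^sup>2 + 2 / pi) * erfi_half t * exp (- (t\<^sup>2 / 2))"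
      by (simp flip: exp_add)
    also have "\<dots> \<le> (1.6268\<^sup>2 + 0.63662) * 2.748140 * (1 / 3)"
      using exp_half t ystar two_div_pi_bounds erfi_half_at_bracket erfi_half_strict_mono[of t "1.6268"] erfi_half_pos[of t]
      by (intro mult_mono add_mono power_mono) auto
    finally have "exp (- (t\<^sup>2)) * crit t \<le> 3.1"
      by (simp add: power_divide)
    then have "(ystar - 1.6267) * (2 * (exp (- (t\<^sup>2)) * crit t)) \<le> 0.0001 * (2 * 3.1)"
      using ystar t pos[of t] by (intro mult_mono) auto
    then show ?thesis
      using t boundary_fun_at_bracket by (simp add: mult.assoc)
  qed
  ultimately show ?thesis
    using that ystar by blast
qed

section \<open>The Mills ratio in the right half-plane\<close>

text \<open>This is the quotient of \<open>gauss_phi (z + t)\<close> and \<open>gauss_phi z\<close>,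
  the integrand of the Mills ratio. A complex \<open>t\<close> admits the complex derivative rules;
  it is evaluated at real points.\<close>

definition "laplace_kernel z t = exp (- z * t - t\<^sup>2 / 2)" for z t :: complex

lemma gauss_phi_add: "gauss_phi (z + t) = gauss_phi z * laplace_kernel z t"
proof -
  have "- ((z + t)\<^sup>2) / 2 = - (z\<^sup>2) / 2 + (- z * t - t\<^sup>2 / 2)"
    by (simp add: field_simps power2_eq_square)
  then show ?thesis
    by (simp only: gauss_phi_def laplace_kernel_def exp_add) simp
qed

lemma gauss_phi_nonzero [simp]: "gauss_phi z \<noteq> 0"
  by (simp add: gauss_phi_def)

lemma norm_laplace_kernel: "cmod (laplace_kernel z (complex_of_real t)) = exp (- (Re z * t) - t\<^sup>2 / 2)"
  by (simp add: laplace_kernel_def power2_eq_square)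

lemma DERIV_laplace_kernel: "(laplace_kernel z has_field_derivative - (z + t) * laplace_kernel z t) (at t)"
  unfolding laplace_kernel_def[abs_def]
  by (auto intro!: derivative_eq_intros simp: algebra_simps)

text \<open>The real part is constant on the vertical segment, so the Gaussian decay in
  \<open>Re w\<close> survives. This gives the decay of \<open>Psi\<close> along every horizontal
  ray.\<close>

lemma norm_Psi_diff_Re_le: "cmod (Psi w - Psi (complex_of_real (Re w))) \<le> exp (((Im w)\<^sup>2 - (Re w)\<^sup>2) / 2) * \<bar>Im w\<bar>"
proof -
  let ?r = "complex_of_real (Re w)"
  have "norm (contour_integral (linepath w ?r) gauss_phi)
      \<le> exp (((Im w)\<^sup>2 - (Re w)\<^sup>2) / 2) * norm (?r - w)"
  proof (rule contour_integral_bound_linepath)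
    show "gauss_phi contour_integrable_on linepath w ?r"
      by (intro contour_integrable_continuous_linepath holomorphic_on_imp_continuous_on gauss_phi_holomorphic)
    fix u assume "u \<in> closed_segment w ?r"
    then obtain s where s: "0 \<le> s" "s \<le> 1" "u = (1 - s) *\<^sub>R w + s *\<^sub>R ?r"
      by (auto simp: closed_segment_def)
    then have re: "Re u = Re w"
      unfolding s(3) by (simp add: left_diff_distrib)
    have "\<bar>Im u\<bar> \<le> \<bar>Im w\<bar>"
      using s by (simp add: abs_mult mult_left_le_one_le)
    then have "(Im u)\<^sup>2 \<le> (Im w)\<^sup>2"
      by (simp add: abs_le_square_iff)
    then have "exp (((Im u)\<^sup>2 - (Re u)\<^sup>2) / 2) / sqrt (2 * pi) \<le> exp (((Im w)\<^sup>2 - (Re w)\<^sup>2) / 2) / 1"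
      using pi_gt3 by (intro frac_le) (auto simp: re)
    then show "norm (gauss_phi u) \<le> exp (((Im w)\<^sup>2 - (Re w)\<^sup>2) / 2)"
      by (simp add: norm_gauss_phi)
  qed auto
  moreover have "norm (?r - w) = \<bar>Im w\<bar>"
    by (simp add: cmod_def)
  ultimately show ?thesis
    by (simp add: contour_integral_gauss_phi)
qed

lemma Psi_shift_tendsto_0: "((\<lambda>t. Psi (z + complex_of_real t)) \<longlongrightarrow> 0) at_top"
proof -
  have lim: "filterlim (\<lambda>t. Re z + t) at_top at_top"
    by (intro filterlim_tendsto_add_at_top[OF tendsto_const] filterlim_ident)
  have "((\<lambda>r. exp (((Im z)\<^sup>2 - r\<^sup>2) / 2) * \<bar>Im z\<bar>) \<longlongrightarrow> 0) at_top"
    by real_asymp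
  from filterlim_compose[OF this lim]
  have "((\<lambda>t. Psi (z + complex_of_real t) - Psi (complex_of_real (Re z + t))) \<longlongrightarrow> 0) at_top"
    by (rule Lim_null_comparison[rotated])
       (use norm_Psi_diff_Re_le[of "z + complex_of_real t" for t] in auto)
  from tendsto_add[OF this filterlim_compose[OF Psi_of_real_tendsto_0 lim]] show ?thesis
    by simp
qed

definition mills :: "complex \<Rightarrow> complex" where
  "mills z = Psi z / gauss_phi z"

text \<open>
  Up to sign, the tails from \<open>t\<close> on of the integrals of \<open>t * laplace_kernel z t\<close> and of
  \<open>(1 - t\<^sup>2) * laplace_kernel z t\<close>, which integration by parts yields for \<open>1 - z * mills z\<close>
  and \<open>z * (1 - z * mills z)\<close>.
\<close>

definition mills_tail1 :: "complex \<Rightarrow> real \<Rightarrow> complex" where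
  "mills_tail1 z t = z * Psi (z + complex_of_real t) / gauss_phi z - laplace_kernel z (complex_of_real t)"

definition mills_tail2 :: "complex \<Rightarrow> real \<Rightarrow> complex" where
  "mills_tail2 z t = z * mills_tail1 z t + complex_of_real t * laplace_kernel z (complex_of_real t)"

lemma mills_tail_0: "mills_tail1 z 0 = z * mills z - 1" "mills_tail2 z 0 = z * (z * mills z - 1)"
  by (simp_all add: mills_tail1_def mills_tail2_def mills_def laplace_kernel_def)

text \<open>Integration by parts in differentiated form: \<open>Psi\<close> contributes - z times
  the kernel, the kernel itself z + t times the kernel.\<close>

lemma has_vector_derivative_mills_tail1:
  "(mills_tail1 z has_vector_derivative t * laplace_kernel z (complex_of_real t)) (at t)"
proof -
  have "((\<lambda>w. Psi (z + w)) has_field_derivative - gauss_phi (z + w) * (0 + 1)) (at w)" for w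
    by (rule DERIV_chain2[OF has_field_derivative_Psi]) (intro DERIV_add DERIV_const DERIV_ident)
  then have "((\<lambda>w. z * Psi (z + w) / gauss_phi z - laplace_kernel z w) has_field_derivative
      z * (- gauss_phi (z + w) * (0 + 1)) / gauss_phi z - (- (z + w) * laplace_kernel z w)) (at w)" for w
    by (intro DERIV_diff DERIV_laplace_kernel DERIV_cdivide DERIV_cmult)
  moreover have "z * (- gauss_phi (z + w) * (0 + 1)) / gauss_phi z - (- (z + w) * laplace_kernel z w)
      = w * laplace_kernel z w" for w
    by (simp add: gauss_phi_add left_diff_distrib)
  ultimately have "((\<lambda>w. z * Psi (z + w) / gauss_phi z - laplace_kernel z w) has_field_derivative
      w * laplace_kernel z w) (at w)" for w
    by simp
  from has_vector_derivative_real_field[OF this] show ?thesis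
    by (simp add: mills_tail1_def[abs_def])
qed

lemma has_vector_derivative_mills_tail2:
  "(mills_tail2 z has_vector_derivative complex_of_real (1 - t\<^sup>2) * laplace_kernel z (complex_of_real t)) (at t)"
proof -
  have "((\<lambda>w. w * laplace_kernel z w) has_field_derivative 1 * laplace_kernel z w + (- (z + w) * laplace_kernel z w) * w) (at w)" for w
    by (intro DERIV_mult DERIV_laplace_kernel DERIV_ident)
  from has_vector_derivative_add[OF has_vector_derivative_mult_right[OF has_vector_derivative_mills_tail1[of z t], of z]
      has_vector_derivative_real_field[OF this[of "complex_of_real t"]]] show ?thesis
    by (simp add: mills_tail2_def[abs_def] algebra_simps power2_eq_square)
qed

lemma norm_laplace_kernel_le:
  assumes "0 \<le> Re z" "0 \<le> t"
  shows "cmod (laplace_kernel z (complex_of_real t)) \<le> exp (- (t\<^sup>2 / 2))"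
  using assms by (simp add: norm_laplace_kernel)

lemma mills_tail_tendsto_0:
  assumes "0 \<le> Re z"
  shows "(mills_tail1 z \<longlongrightarrow> 0) at_top" "(mills_tail2 z \<longlongrightarrow> 0) at_top"
proof -
  have 1: "((\<lambda>t. laplace_kernel z (complex_of_real t)) \<longlongrightarrow> 0) at_top"
    by (rule Lim_null_comparison[where g = "\<lambda>t. exp (- (t\<^sup>2 / 2))"])
       (use norm_laplace_kernel_le[OF assms] in \<open>auto intro: eventually_mono[OF eventually_ge_at_top[of 0]]\<close>, real_asymp)
  have 2: "((\<lambda>t. complex_of_real t * laplace_kernel z (complex_of_real t)) \<longlongrightarrow> 0) at_top"
  proof (rule Lim_null_comparison[where g = "\<lambda>t. t * exp (- (t\<^sup>2 / 2))"])
    show "\<forall>\<^sub>F t in at_top. cmod (complex_of_real t * laplace_kernel z (complex_of_real t)) \<le> t * exp (- (t\<^sup>2 / 2))"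
      using eventually_ge_at_top[of 0]
      by eventually_elim (use norm_laplace_kernel_le[OF assms] in \<open>auto simp: norm_mult intro!: mult_left_mono\<close>)
  qed real_asymp
  show tail1: "(mills_tail1 z \<longlongrightarrow> 0) at_top"
    using tendsto_diff[OF tendsto_divide[OF tendsto_mult[OF tendsto_const Psi_shift_tendsto_0] tendsto_const gauss_phi_nonzero] 1,
        of z z z]
    by (simp add: mills_tail1_def[abs_def])
  show "(mills_tail2 z \<longlongrightarrow> 0) at_top"
    using tendsto_add[OF tendsto_mult[OF tendsto_const tail1] 2, of z]
    by (simp add: mills_tail2_def[abs_def])
qed

text \<open>The left side is the modulus of the integral of (1 - t^2) times the kernel over t > 0.
  The integrand is dominated by 8 / (1 + t^2), with primitive 8 arctan t. So z *
  \<open>mills z\<close> - 1 is O(1 / |z|) uniformly up to the axis.\<close>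

lemma norm_mills_le:
  assumes "0 \<le> Re z"
  shows "cmod z * cmod (z * mills z - 1) \<le> 4 * pi"
proof -
  have "cmod (mills_tail2 z T - mills_tail2 z 0) \<le> 8 * arctan T - 8 * arctan 0" if "0 < T" for T
  proof (rule differentiable_bound_general[OF that])
    show "continuous_on {0..T} (mills_tail2 z)"
      by (intro continuous_at_imp_continuous_on ballI has_vector_derivative_continuous[OF has_vector_derivative_mills_tail2])
    show "continuous_on {0..T} (\<lambda>t. 8 * arctan t)"
      by (intro continuous_intros)
    fix t :: real assume t: "0 < t" "t < T"
    show "(mills_tail2 z has_vector_derivative complex_of_real (1 - t\<^sup>2) * laplace_kernel z (complex_of_real t)) (at t)"
      by (rule has_vector_derivative_mills_tail2)
    show "((\<lambda>t. 8 * arctan t) has_vector_derivative 8 * inverse (1 + t\<^sup>2)) (at t)"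
      unfolding has_real_derivative_iff_has_vector_derivative[symmetric]
      by (intro DERIV_cmult DERIV_arctan)
    \<comment> \<open>Three Taylor terms suffice: the right side is 8 + 4 t^2 + t^4.\<close>
    have "(1 + t\<^sup>2)\<^sup>2 \<le> 8 * (1 + t\<^sup>2 / 2 + (t\<^sup>2 / 2)\<^sup>2 / 2)"
      by (simp add: power2_sum power_divide)
    also have "\<dots> \<le> 8 * exp (t\<^sup>2 / 2)"
      by (intro mult_left_mono exp_lower_Taylor_quadratic) auto
    finally have "(1 + t\<^sup>2) * exp (- (t\<^sup>2 / 2)) \<le> 8 * inverse (1 + t\<^sup>2)"
      by (simp add: exp_minus field_simps power2_eq_square add_pos_nonneg)
    moreover have "cmod (complex_of_real (1 - t\<^sup>2)) \<le> 1 + t\<^sup>2"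
      unfolding norm_of_real by (simp add: abs_le_iff)
    then have "cmod (complex_of_real (1 - t\<^sup>2) * laplace_kernel z (complex_of_real t)) \<le> (1 + t\<^sup>2) * exp (- (t\<^sup>2 / 2))"
      unfolding norm_mult using norm_laplace_kernel_le[OF assms, of t] t by (intro mult_mono) auto
    ultimately show "cmod (complex_of_real (1 - t\<^sup>2) * laplace_kernel z (complex_of_real t)) \<le> 8 * inverse (1 + t\<^sup>2)"
      by simp
  qed
  moreover have "8 * arctan T \<le> 4 * pi" for T
    using arctan_ubound[of T] by simp
  ultimately have "\<forall>\<^sub>F T in at_top. cmod (mills_tail2 z T - mills_tail2 z 0) \<le> 4 * pi"
    by (intro eventually_mono[OF eventually_gt_at_top[of 0]]) (fastforce intro: order_trans)
  moreover have "((\<lambda>T. cmod (mills_tail2 z T - mills_tail2 z 0)) \<longlongrightarrow> cmod (0 - mills_tail2 z 0)) at_top"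
    by (intro tendsto_intros mills_tail_tendsto_0 assms)
  ultimately have "cmod (0 - mills_tail2 z 0) \<le> 4 * pi"
    by (intro tendsto_upperbound) auto
  then show ?thesis
    by (simp add: mills_tail_0 norm_mult)
qed

text \<open>The number 1 - z * \<open>mills z\<close> is the integral of t times the kernel, and t
  exp (- t^2 / 2) has integral 1 over t > 0. Strictness excludes zeros of
  \<open>mills\<close>.\<close>

lemma norm_mills_less_1:
  assumes "0 < Re z"
  shows "cmod (z * mills z - 1) < 1"
proof -
  have bound: "cmod (mills_tail1 z T - mills_tail1 z s) \<le> - (q * exp (- (T\<^sup>2 / 2))) - - (q * exp (- (s\<^sup>2 / 2)))"
    if "s < T" "0 \<le> s" "exp (- (Re z * s)) = q" for s T q
  proof (rule differentiable_bound_general[OF that(1)])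
    show "continuous_on {s..T} (mills_tail1 z)"
      by (intro continuous_at_imp_continuous_on ballI has_vector_derivative_continuous[OF has_vector_derivative_mills_tail1])
    show "continuous_on {s..T} (\<lambda>t. - (q * exp (- (t\<^sup>2 / 2))))"
      by (intro continuous_intros) auto
    fix t :: real assume t: "s < t" "t < T"
    show "(mills_tail1 z has_vector_derivative t * laplace_kernel z (complex_of_real t)) (at t)"
      by (rule has_vector_derivative_mills_tail1)
    show "((\<lambda>t. - (q * exp (- (t\<^sup>2 / 2)))) has_vector_derivative t * (q * exp (- (t\<^sup>2 / 2)))) (at t)"
      unfolding has_real_derivative_iff_has_vector_derivative[symmetric]
      by (auto intro!: derivative_eq_intros)
    have "exp (- (Re z * t)) \<le> q"
      using that t assms by auto
    then have "exp (- (Re z * t)) * exp (- (t\<^sup>2 / 2)) \<le> q * exp (- (t\<^sup>2 / 2))"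
      by simp
    then have "t * (exp (- (Re z * t)) * exp (- (t\<^sup>2 / 2))) \<le> t * (q * exp (- (t\<^sup>2 / 2)))"
      using that t by (intro mult_left_mono) auto
    then show "cmod (t * laplace_kernel z (complex_of_real t)) \<le> t * (q * exp (- (t\<^sup>2 / 2)))"
      using that t by (simp add: norm_mult norm_laplace_kernel flip: exp_add)
  qed
  \<comment> \<open>Splitting the integral at \<open>t = 1\<close>, beyond which \<open>exp (- Re z * t)\<close> gains the factor \<open>?q < 1\<close>, makes the bound strict.\<close>
  let ?q = "exp (- Re z)"
  have "\<forall>\<^sub>F T in at_top. cmod (mills_tail1 z T - mills_tail1 z 1) \<le> ?q * exp (- (1 / 2))"
  proof (rule eventually_mono[OF eventually_gt_at_top[of 1]])
    fix T :: real assume "1 < T"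
    then show "cmod (mills_tail1 z T - mills_tail1 z 1) \<le> ?q * exp (- (1 / 2))"
      by (intro order_trans[OF bound[of 1 T]]) auto
  qed
  moreover have "((\<lambda>T. cmod (mills_tail1 z T - mills_tail1 z 1)) \<longlongrightarrow> cmod (0 - mills_tail1 z 1)) at_top"
    using assms by (intro tendsto_intros mills_tail_tendsto_0) auto
  ultimately have "cmod (0 - mills_tail1 z 1) \<le> ?q * exp (- (1 / 2))"
    by (intro tendsto_upperbound) auto
  also have "\<dots> < exp (- (1 / 2))"
    using assms by simp
  finally have "cmod (mills_tail1 z 1) < exp (- (1 / 2))"
    by simp
  moreover have "cmod (mills_tail1 z 1 - mills_tail1 z 0) \<le> 1 - exp (- (1 / 2))"
    using bound[of 0 1] by simp
  moreover have "cmod (mills_tail1 z 0) \<le> cmod (mills_tail1 z 1) + cmod (mills_tail1 z 1 - mills_tail1 z 0)"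
    by (metis norm_minus_commute norm_triangle_sub)
  ultimately show ?thesis
    by (simp add: mills_tail_0)
qed

lemma Psi_nonzero:
  assumes "z \<in> H_plus"
  shows "Psi z \<noteq> 0"
proof (cases "Re z = 0")
  case True
  then have "z = \<i> * complex_of_real (Im z)"
    by (simp add: complex_eq_iff)
  then have "Psi z = Complex (1 / 2) (- erfi_half (Im z) / sqrt (2 * pi))"
    using Psi_imaginary by metis
  then show ?thesis
    by (simp add: complex_eq_iff)
next
  case False
  with assms have "cmod (z * mills z - 1) < 1"
    by (intro norm_mills_less_1) (simp add: H_plus_def)
  then show ?thesis
    by (auto simp: mills_def)
qed

section \<open>Maximum modulus in the right half-plane\<close>

lemma interior_H_plus: "interior H_plus = {z. 0 < Re z}"
  using interior_halfspace_ge[of "1 :: complex" 0] by (simp add: H_plus_def)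

lemma closure_Re_pos: "closure {z. 0 < Re z} = H_plus"
  using closure_halfspace_gt[of "1 :: complex" 0] by (simp add: H_plus_def)

text \<open>A sequence of test points going to infinity; \<open>Suc\<close> keeps it off 0 and
  inside the open half-plane.\<close>

lemma filterlim_of_nat_at_infinity_H_plus:
  "filterlim (\<lambda>n. complex_of_real (real (Suc n))) (inf at_infinity (principal H_plus)) sequentially"
proof -
  have "filterlim (\<lambda>n. of_nat (Suc n) :: complex) at_infinity sequentially"
    by (rule filterlim_compose[OF tendsto_of_nat filterlim_Suc])
  then show ?thesis
    by (simp add: filterlim_inf filterlim_principal H_plus_def)
qed

text \<open>Maximum modulus on a half-disc that contains \<open>z\<close>: the diameter is covered
  by the bound on the axis, and the arc lies so far out that f is within e of l.\<close>

lemma half_plane_maximum_modulus: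
  assumes hol: "f holomorphic_on {z. 0 < Re z}" and cont: "continuous_on H_plus f"
    and lim: "(f \<longlongrightarrow> l) (inf at_infinity (principal H_plus))" and l: "cmod l \<le> B"
    and boundary: "\<And>y. cmod (f (\<i> * complex_of_real y)) \<le> B"
    and z: "z \<in> H_plus"
  shows "cmod (f z) \<le> B"
proof (rule field_le_epsilon)
  fix e :: real assume e: "0 < e"
  have "\<forall>\<^sub>F w in inf at_infinity (principal H_plus). dist (f w) l < e"
    by (rule tendstoD[OF lim e])
  then obtain R where R: "\<And>w. w \<in> H_plus \<Longrightarrow> R \<le> cmod w \<Longrightarrow> dist (f w) l < e"
    by (auto simp: eventually_inf_principal eventually_at_infinity)
  define r where "r = max R (cmod z)"
  let ?S = "H_plus \<inter> cball 0 r"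
  have cl: "closed ?S"
    by (intro closed_Int) (simp_all add: flip: closure_Re_pos)
  show "cmod (f z) \<le> B + e"
  proof (rule maximum_modulus_frontier[of f ?S])
    show "f holomorphic_on interior ?S"
      using hol by (rule holomorphic_on_subset) (auto simp: interior_Int interior_H_plus)
    show "continuous_on (closure ?S) f"
      using cont by (rule continuous_on_subset) (simp add: closure_closed[OF cl])
    show "bounded ?S"
      by (simp add: bounded_Int)
    show "z \<in> ?S"
      using z by (simp add: r_def)
    fix w assume "w \<in> frontier ?S"
    then have w: "w \<in> H_plus" "cmod w \<le> r" "w \<notin> interior ?S"
      using cl by (auto simp: frontier_def)
    show "cmod (f w) \<le> B + e"
    proof (cases "Re w = 0")
      case True
      then have "w = \<i> * complex_of_real (Im w)"
        by (simp add: complex_eq_iff)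
      with boundary[of "Im w"] e show ?thesis
        by simp
    next
      case False
      with w have "cmod w = r"
        unfolding interior_Int interior_H_plus by (auto simp: H_plus_def)
      with R[OF w(1)] have "dist (f w) l < e"
        by (simp add: r_def)
      then show ?thesis
        using norm_triangle_sub[of "f w" l] l by (simp add: dist_norm)
    qed
  qed
qed

text \<open>Otherwise f is constant in the open half-plane. The limit at infinity identifies the
  constant as l, and continuity carries it to \<open>w\<close>, where f differs from l.\<close>

lemma half_plane_strict_maximum_modulus:
  assumes hol: "f holomorphic_on {z. 0 < Re z}" and cont: "continuous_on H_plus f"
    and lim: "(f \<longlongrightarrow> l) (inf at_infinity (principal H_plus))" and l: "cmod l \<le> B"
    and boundary: "\<And>y. cmod (f (\<i> * complex_of_real y)) \<le> B"
    and w: "w \<in> H_plus" "f w \<noteq> l"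
    and z: "0 < Re z"
  shows "cmod (f z) < B"
proof (rule ccontr)
  assume contra: "\<not> cmod (f z) < B"
  have opn: "open {z. 0 < Re z}"
    by (simp add: open_halfspace_Re_gt)
  have "f constant_on {z. 0 < Re z}"
  proof (rule maximum_modulus_principle[OF hol opn _ opn order_refl])
    show "connected {z. 0 < Re z}"
      by (intro convex_connected convex_halfspace_Re_gt)
    fix u :: complex assume "u \<in> {z. 0 < Re z}"
    then have "cmod (f u) \<le> B"
      by (intro half_plane_maximum_modulus[OF hol cont lim l boundary]) (simp add: H_plus_def)
    with contra show "cmod (f u) \<le> cmod (f z)"
      by simp
  qed (use z in simp)
  then obtain c where c: "\<And>u. 0 < Re u \<Longrightarrow> f u = c"
    by (auto simp: constant_on_def)
  have "(\<lambda>n. f (complex_of_real (real (Suc n)))) \<longlonglongrightarrow> l"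
    by (rule filterlim_compose[OF lim filterlim_of_nat_at_infinity_H_plus])
  then have "c = l"
    by (simp add: c LIMSEQ_const_iff)
  moreover have "f w = c"
    by (rule continuous_constant_on_closure[of "{z. 0 < Re z}"]) (use cont c w in \<open>auto simp: closure_Re_pos\<close>)
  ultimately show False
    using w by simp
qed

section \<open>The reciprocal of S and the limit at infinity\<close>

definition S_recip :: "complex \<Rightarrow> complex" where
  "S_recip z = mills z * (z + complex_of_real (sqrt (2 / pi)))"

lemma S_ratio_eq_inverse: "S_ratio z = inverse (S_recip z)"
  by (simp add: S_ratio_def S_recip_def inv_mills_def mills_def divide_inverse mult_ac)

lemma S_recip_holomorphic: "S_recip holomorphic_on A"
  unfolding S_recip_def[abs_def] mills_def[abs_def]
  by (intro holomorphic_intros Psi_entire gauss_phi_holomorphic) simp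

lemma S_recip_nonzero:
  assumes "z \<in> H_plus"
  shows "S_recip z \<noteq> 0"
proof -
  have "0 < Re (z + complex_of_real (sqrt (2 / pi)))"
    using assms by (simp add: H_plus_def add_nonneg_pos)
  then have "z + complex_of_real (sqrt (2 / pi)) \<noteq> 0"
    by force
  then show ?thesis
    using Psi_nonzero[OF assms] by (simp add: S_recip_def mills_def)
qed

lemma S_ratio_holomorphic:
  assumes "A \<subseteq> H_plus"
  shows "S_ratio holomorphic_on A"
  unfolding S_ratio_eq_inverse[abs_def]
  by (intro holomorphic_intros S_recip_holomorphic) (use S_recip_nonzero assms in blast)

lemma S_ratio_0: "S_ratio 0 = 1"
  by (simp add: S_ratio_def inv_mills_def Psi_0 gauss_phi_def real_sqrt_mult real_sqrt_divide
      flip: of_real_mult of_real_divide)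

lemma S_recip_tendsto_1: "(S_recip \<longlongrightarrow> 1) (inf at_infinity (principal H_plus))"
proof -
  have inv: "((\<lambda>z :: complex. inverse z) \<longlongrightarrow> 0) (inf at_infinity (principal H_plus))"
    by (rule tendsto_mono[OF inf_le1 tendsto_inverse_0])
  have "((\<lambda>z. z * mills z - 1) \<longlongrightarrow> 0) (inf at_infinity (principal H_plus))"
  proof (rule Lim_null_comparison)
    show "((\<lambda>z. 4 * pi * cmod (inverse z)) \<longlongrightarrow> 0) (inf at_infinity (principal H_plus))"
      using tendsto_mult[OF tendsto_const tendsto_norm[OF inv], of "4 * pi"] by simp
    have "\<forall>\<^sub>F z :: complex in at_infinity. 0 < cmod z"
      by (auto simp: eventually_at_infinity intro: exI[of _ 1])
    then show "\<forall>\<^sub>F z in inf at_infinity (principal H_plus). cmod (z * mills z - 1) \<le> 4 * pi * cmod (inverse z)"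
      unfolding eventually_inf_principal
    proof eventually_elim
      fix z :: complex assume z: "0 < cmod z"
      show "z \<in> H_plus \<longrightarrow> cmod (z * mills z - 1) \<le> 4 * pi * cmod (inverse z)"
      proof
        assume "z \<in> H_plus"
        then have "cmod (z * mills z - 1) * cmod z \<le> 4 * pi"
          using norm_mills_le[of z] by (simp add: H_plus_def mult.commute)
        then have "cmod (z * mills z - 1) \<le> 4 * pi / cmod z"
          by (rule pos_le_divide_eq[OF z, THEN iffD2])
        then show "cmod (z * mills z - 1) \<le> 4 * pi * cmod (inverse z)"
          unfolding norm_inverse divide_inverse .
      qed
    qed
  qed
  from tendsto_add[OF this tendsto_const[of 1]]
  have zM: "((\<lambda>z. z * mills z) \<longlongrightarrow> 1) (inf at_infinity (principal H_plus))"
    by simp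
  have "((\<lambda>z. z * mills z * (1 + complex_of_real (sqrt (2 / pi)) * inverse z)) \<longlongrightarrow> 1 * (1 + complex_of_real (sqrt (2 / pi)) * 0))
      (inf at_infinity (principal H_plus))"
    by (intro tendsto_intros zM inv)
  moreover have "\<forall>\<^sub>F z in inf at_infinity (principal H_plus).
      z * mills z * (1 + complex_of_real (sqrt (2 / pi)) * inverse z) = S_recip z"
  proof -
    have "\<forall>\<^sub>F z :: complex in at_infinity. z \<noteq> 0"
      by (auto simp: eventually_at_infinity intro: exI[of _ 1])
    then show ?thesis
      unfolding eventually_inf_principal
      by eventually_elim (auto simp: S_recip_def field_simps)
  qed
  ultimately show ?thesis
    by (simp add: tendsto_cong)
qed

lemma S_ratio_tendsto_1: "(S_ratio \<longlongrightarrow> 1) (inf at_infinity (principal H_plus))"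
  using tendsto_inverse[OF S_recip_tendsto_1] by (simp add: S_ratio_eq_inverse[abs_def])

lemma norm_S_recip_imaginary: "cmod (S_recip (\<i> * complex_of_real y)) = sqrt (boundary_fun y)"
  using norm_S_ratio_imaginary[of y] by (simp add: S_ratio_eq_inverse norm_inverse flip: inverse_eq_divide)

text \<open>The limit of \<open>S_recip\<close> along the imaginary axis replaces an asymptotic
  expansion of \<open>erfi_half\<close>.\<close>

lemma boundary_fun_tendsto_1: "(boundary_fun \<longlongrightarrow> 1) at_top"
proof -
  have "filterlim (\<lambda>y. \<i> * complex_of_real y) at_infinity at_top"
    by (rule filterlim_norm_at_top_imp_at_infinity) (simp add: norm_mult filterlim_abs_real)
  then have "filterlim (\<lambda>y. \<i> * complex_of_real y) (inf at_infinity (principal H_plus)) at_top"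
    by (simp add: filterlim_inf filterlim_principal H_plus_def)
  from tendsto_norm[OF filterlim_compose[OF S_recip_tendsto_1 this]]
  have "((\<lambda>y. (sqrt (boundary_fun y))\<^sup>2) \<longlongrightarrow> 1\<^sup>2) at_top"
    by (intro tendsto_power) (simp add: norm_S_recip_imaginary)
  then show ?thesis
    using boundary_fun_pos by (simp add: less_imp_le)
qed

lemma boundary_fun_max:
  obtains ystar where "1.6267 < ystar" "ystar < 1.6268"
    "2.119 < boundary_fun ystar" "boundary_fun ystar < 2.1248"
    "\<And>y. y \<noteq> 0 \<Longrightarrow> 1 < boundary_fun y"
    "\<And>y. y \<noteq> ystar \<Longrightarrow> y \<noteq> - ystar \<Longrightarrow> boundary_fun y < boundary_fun ystar"
proof -
  obtain ystar where ystar: "1.6267 < ystar" "ystar < 1.6268"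
    and incr: "\<And>x y. 0 \<le> x \<Longrightarrow> x < y \<Longrightarrow> y \<le> ystar \<Longrightarrow> boundary_fun x < boundary_fun y"
    and decr: "\<And>x y. ystar \<le> x \<Longrightarrow> x < y \<Longrightarrow> boundary_fun y < boundary_fun x"
    and val: "2.119 < boundary_fun ystar" "boundary_fun ystar < 2.1248"
    using boundary_fun_unimodal by blast
  have abs: "boundary_fun \<bar>y\<bar> = boundary_fun y" for y
    by (simp add: abs_if boundary_fun_minus)
  have gt1: "1 < boundary_fun y" if "0 < y" for y
  proof (cases "y \<le> ystar")
    case True
    then show ?thesis
      using incr[of 0 y] that by simp
  next
    \<comment> \<open>The limit yields only the weak inequality at y + 1; strict decrease from y to
      y + 1 sharpens it.\<close>
    case False
    have "\<forall>\<^sub>F t in at_top. boundary_fun t \<le> boundary_fun (y + 1)"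
      by (rule eventually_mono[OF eventually_gt_at_top[of "y + 1"]]) (use decr[of "y + 1"] False in \<open>simp add: less_imp_le\<close>)
    then have "1 \<le> boundary_fun (y + 1)"
      by (rule tendsto_upperbound[OF boundary_fun_tendsto_1]) simp
    also have "\<dots> < boundary_fun y"
      using decr False by simp
    finally show ?thesis .
  qed
  have "1 < boundary_fun y" if "y \<noteq> 0" for y
    using gt1[of "\<bar>y\<bar>"] that by (simp add: abs)
  moreover have "boundary_fun y < boundary_fun ystar" if "y \<noteq> ystar" "y \<noteq> - ystar" for y
  proof -
    have "\<bar>y\<bar> < ystar \<or> ystar < \<bar>y\<bar>"
      using that by linarith
    then have "boundary_fun \<bar>y\<bar> < boundary_fun ystar"
      using incr[of "\<bar>y\<bar>" ystar] decr[of ystar "\<bar>y\<bar>"] by auto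
    then show ?thesis
      by (simp add: abs)
  qed
  ultimately show ?thesis
    using that ystar val by blast
qed

theorem theorem1p1:
  shows "(\<forall>z \<in> H_plus. Psi z \<noteq> 0)
    \<and> S_ratio holomorphic_on interior H_plus
    \<and> (\<exists>ystar::real.
          {y. is_arg_min (\<lambda>t::real. cmod (S_ratio (\<i> * complex_of_real t))) (\<lambda>t. 0 < t) y} = {ystar}
        \<and> 1.6267 \<le> ystar \<and> ystar < 1.6268
        \<and> 0.686 \<le> cmod (S_ratio (\<i> * complex_of_real ystar))
        \<and> cmod (S_ratio (\<i> * complex_of_real ystar)) < 0.687
        \<and> (\<forall>z \<in> H_plus - {0, \<i> * complex_of_real ystar, - (\<i> * complex_of_real ystar)}.
              1 > cmod (S_ratio z) \<and> cmod (S_ratio z) > cmod (S_ratio (\<i> * complex_of_real ystar)))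
        \<and> (\<forall>c > cmod (S_ratio (\<i> * complex_of_real ystar)).
              \<not> (\<forall>z \<in> H_plus - {0, \<i> * complex_of_real ystar, - (\<i> * complex_of_real ystar)}.
                    cmod (S_ratio z) > c))
        \<and> (\<forall>c < 1.
              \<not> (\<forall>z \<in> H_plus - {0, \<i> * complex_of_real ystar, - (\<i> * complex_of_real ystar)}.
                    c > cmod (S_ratio z))))
    \<and> S_ratio 0 = 1
    \<and> (S_ratio \<longlongrightarrow> 1) (inf at_infinity (principal H_plus))"
proof -
  obtain ystar where ystar: "1.6267 < ystar" "ystar < 1.6268"
    and val: "2.119 < boundary_fun ystar" "boundary_fun ystar < 2.1248"
    and gt1: "\<And>y. y \<noteq> 0 \<Longrightarrow> 1 < boundary_fun y"
    and max: "\<And>y. y \<noteq> ystar \<Longrightarrow> y \<noteq> - ystar \<Longrightarrow> boundary_fun y < boundary_fun ystar"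
    using boundary_fun_max by blast
  let ?w = "\<i> * complex_of_real ystar"
  let ?A = "H_plus - {0, ?w, - ?w}"
  have w: "?w \<in> H_plus"
    by (simp add: H_plus_def)
  have norm_w: "cmod (S_ratio ?w) = 1 / sqrt (boundary_fun ystar)"
    by (rule norm_S_ratio_imaginary)
  have less_iff: "cmod (S_ratio (\<i> * complex_of_real s)) < cmod (S_ratio (\<i> * complex_of_real t))
      \<longleftrightarrow> boundary_fun t < boundary_fun s" for s t
    using boundary_fun_pos[of s] boundary_fun_pos[of t] by (simp add: norm_S_ratio_imaginary divide_simps)
  have argmin: "{y. is_arg_min (\<lambda>t::real. cmod (S_ratio (\<i> * complex_of_real t))) (\<lambda>t. 0 < t) y} = {ystar}"
    unfolding is_arg_min_def less_iff using max ystar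
    by (auto; smt (verit, ccfv_threshold))
  have lower_val: "0.686 \<le> cmod (S_ratio ?w)"
  proof -
    have "sqrt (boundary_fun ystar) \<le> 1 / 0.686"
      using val by (intro real_le_lsqrt) (simp_all add: power_divide)
    then show ?thesis
      using val by (simp add: norm_w field_simps)
  qed
  have upper_val: "cmod (S_ratio ?w) < 0.687"
  proof -
    have "1 / 0.687 < sqrt (boundary_fun ystar)"
      using val by (intro real_less_rsqrt) (simp add: power_divide)
    then show ?thesis
      using val by (simp add: norm_w field_simps)
  qed
  have holo: "S_ratio holomorphic_on {z. 0 < Re z}"
    by (rule S_ratio_holomorphic) (auto simp: H_plus_def)
  have bounds: "cmod (S_ratio z) < 1 \<and> cmod (S_ratio ?w) < cmod (S_ratio z)" if z: "z \<in> ?A" for z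
  proof (cases "Re z = 0")
    case True
    then have z_eq: "z = \<i> * complex_of_real (Im z)"
      by (simp add: complex_eq_iff)
    then have "Im z \<noteq> 0" "Im z \<noteq> ystar" "Im z \<noteq> - ystar"
      using z by auto
    then show ?thesis
      using gt1[of "Im z"] max[of "Im z"] less_iff[of ystar "Im z"] norm_S_ratio_imaginary[of "Im z"]
      by (simp flip: z_eq)
  next
    case False
    then have pos: "0 < Re z"
      using z by (simp add: H_plus_def)
    have ge1: "1 \<le> boundary_fun y" for y
      using gt1[of y] by (cases "y = 0") auto
    \<comment> \<open>The point \<open>?w\<close> shows that S is not constantly 1, since |S| <
      0.687 there; it serves for the reciprocal as well.\<close>
    have "cmod (S_ratio z) < 1"
    proof (rule half_plane_strict_maximum_modulus[OF holo _ S_ratio_tendsto_1 _ _ w _ pos])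
      show "continuous_on H_plus S_ratio"
        by (intro holomorphic_on_imp_continuous_on S_ratio_holomorphic order_refl)
      show "cmod (S_ratio (\<i> * complex_of_real y)) \<le> 1" for y
        using ge1[of y] by (simp add: norm_S_ratio_imaginary)
      show "S_ratio ?w \<noteq> 1"
        using upper_val by auto
    qed simp
    moreover have "cmod (S_recip z) < sqrt (boundary_fun ystar)"
    proof (rule half_plane_strict_maximum_modulus[OF S_recip_holomorphic _ S_recip_tendsto_1 _ _ w _ pos])
      show "continuous_on H_plus S_recip"
        by (intro holomorphic_on_imp_continuous_on S_recip_holomorphic)
      show "cmod 1 \<le> sqrt (boundary_fun ystar)"
        using ge1[of ystar] by simp
      show "cmod (S_recip (\<i> * complex_of_real y)) \<le> sqrt (boundary_fun ystar)" for y
        using max[of y] boundary_fun_minus[of ystar]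
        by (cases "y = ystar \<or> y = - ystar") (auto simp: norm_S_recip_imaginary)
      show "S_recip ?w \<noteq> 1"
        using upper_val by (auto simp: S_ratio_eq_inverse)
    qed
    then have "1 / sqrt (boundary_fun ystar) < cmod (S_ratio z)"
      using S_recip_nonzero[of z] z by (simp add: S_ratio_eq_inverse norm_divide inverse_eq_divide frac_less2)
    ultimately show ?thesis
      by (simp add: norm_w)
  qed
  \<comment> \<open>The minimiser itself is excluded from \<open>?A\<close>, so continuity is used
    at points just above it on the axis.\<close>
  have sharp_lower: "\<not> (\<forall>z \<in> ?A. c < cmod (S_ratio z))" if c: "cmod (S_ratio ?w) < c" for c
  proof -
    have "isCont boundary_fun ystar"
      by (rule DERIV_isCont[OF DERIV_boundary_fun])
    then have "((\<lambda>y. 1 / sqrt (boundary_fun y)) \<longlongrightarrow> 1 / sqrt (boundary_fun ystar)) (at_right ystar)"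
      using boundary_fun_pos[of ystar]
      by (intro tendsto_intros) (auto simp: isCont_def intro: filterlim_mono[OF _ order_refl at_le])
    from order_tendstoD(2)[OF this, of c] c
    have "\<forall>\<^sub>F y in at_right ystar. cmod (S_ratio (\<i> * complex_of_real y)) < c"
      by (simp add: norm_S_ratio_imaginary)
    then have "\<forall>\<^sub>F y in at_right ystar. cmod (S_ratio (\<i> * complex_of_real y)) < c \<and> ystar < y"
      by (intro eventually_conj eventually_at_right_less)
    then obtain y where y: "cmod (S_ratio (\<i> * complex_of_real y)) < c" "ystar < y"
      using eventually_happens'[of "at_right ystar"] by auto
    then have "\<i> * complex_of_real y \<in> ?A"
      using ystar by (auto simp: H_plus_def complex_eq_iff)
    with y show ?thesis
      by force
  qed
  have sharp_upper: "\<not> (\<forall>z \<in> ?A. cmod (S_ratio z) < c)" if c: "c < 1" for c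
  proof -
    have "(\<lambda>n. cmod (S_ratio (complex_of_real (real (Suc n))))) \<longlonglongrightarrow> cmod 1"
      by (rule tendsto_norm[OF filterlim_compose[OF S_ratio_tendsto_1 filterlim_of_nat_at_infinity_H_plus]])
    from order_tendstoD(1)[OF this, of c] c
    obtain n where n: "c < cmod (S_ratio (complex_of_real (real (Suc n))))"
      using eventually_happens'[OF sequentially_bot] by auto
    moreover have "complex_of_real (real (Suc n)) \<in> ?A"
      by (auto simp: H_plus_def complex_eq_iff simp del: of_nat_Suc)
    ultimately show ?thesis
      by force
  qed
  have "S_ratio holomorphic_on interior H_plus"
    by (rule S_ratio_holomorphic[OF interior_subset])
  then show ?thesis
    using Psi_nonzero argmin ystar lower_val upper_val bounds sharp_lower sharp_upper S_ratio_0 S_ratio_tendsto_1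
    by (intro conjI exI[of _ ystar]) (auto simp: less_imp_le)
qed

end
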